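(* Let $M>0$ and let $T:\mathbb{R}\to\mathbb{R}_+$ be a function such that, as $u\to\infty$, $\sqrt{u}=o(T(u))$ and $T(u)=o(u)$. Then $$\lim_{u\to\infty}\frac{1}{\sqrt{u}}\log\mathbb{P}\left(\int_0^{T(u)}Q(r)\,\mathrm{d}r>Mu\right)=-\frac{2}{3}\sqrt{6}\,c\sqrt{cM}.$$
   Context: $\{B(t):t\in\mathbb{R}\}$ is a two-sided standard Brownian motion ($B(0)=0$, $\mathbb{E}B(t)=0$, $\mathrm{Var}\,B(t)=|t|$), and $c>0$ is a fixed constant. The stationary workload (Brownian storage) process is $Q(t)=\sup_{s\le t}\left(B(t)-B(s)-c(t-s)\right)$, $t\in\mathbb{R}$. Here $\mathbb{R}_+=(0,\infty)$. *)

theory Defs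
  imports "HOL-Probability.Probability" "HOL-Library.Landau_Symbols"
begin

text \<open>
  Paths are continuous, and start at 0, at every sample point rather than almost surely:
  the probability space is not assumed to be complete, so this is what makes path functionals
  such as suprema over uncountable time sets measurable.
  The second parameter of \<^const>\<open>normal_density\<close> is the standard deviation.
\<close>

locale two_sided_brownian_motion = prob_space P
  for P :: "'a measure" and B :: "real \<Rightarrow> 'a \<Rightarrow> real" +
  assumes start_zero: "\<omega> \<in> space P \<Longrightarrow> B 0 \<omega> = 0"
    and continuous_paths: "\<omega> \<in> space P \<Longrightarrow> continuous_on UNIV (\<lambda>t. B t \<omega>)"
    and normal_increments: "s < t \<Longrightarrow>
      distributed P lborel (\<lambda>\<omega>. B t \<omega> - B s \<omega>) (normal_density 0 (sqrt (t - s)))"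
    and indep_increments: "\<And>(n::nat) \<tau>. strict_mono_on {..n} \<tau> \<Longrightarrow>
      indep_vars (\<lambda>_. borel) (\<lambda>i \<omega>. B (\<tau> (Suc i)) \<omega> - B (\<tau> i) \<omega>) {..<n}"

text \<open>
  The supremum is finite almost surely when \<open>B\<close> is a Brownian motion and \<open>c > 0\<close>; on the
  null set where it is infinite, the real-valued \<^const>\<open>Sup\<close> is an unspecified constant.
\<close>

definition workload :: "real \<Rightarrow> (real \<Rightarrow> 'a \<Rightarrow> real) \<Rightarrow> real \<Rightarrow> 'a \<Rightarrow> real" where
  "workload c B t \<omega> = (SUP s\<in>{..t}. B t \<omega> - B s \<omega> - c * (t - s))"

end

theory Submission
  imports Defs "HOL-Real_Asymp.Real_Asymp"
begin

text \<open>
  Lower bound: \<open>Q t \<ge> B t - c t\<close>, so the area exceeds that of a drifted Brownian path on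
  \<open>[0, L]\<close>, which is Gaussian; \<open>L = sqrt (6 M u / c)\<close> gives the right exponent.

  Upper bound: cut \<open>[0, T u]\<close> into \<open>N = o(sqrt u)\<close> blocks of length \<open>h \<le> \<delta> sqrt u\<close>. In each block the
  workload is at most its value at the start of the block plus the workload restarted from \<open>0\<close>
  there. The restarted workloads have exponential tails, so their total area exceeds \<open>\<eta> u\<close>
  with probability at most \<open>C ^ N exp (- c \<eta> u / h)\<close>, which is negligible for small \<open>\<delta>\<close>. The values \<open>Q j\<close>
  at the block starts satisfy \<open>Q (j + 1) = max (Q j + X j - c h) (r (j + 1))\<close> with \<open>X j\<close> the Brownian
  increment and \<open>r (j + 1)\<close> the final restarted workload. Charging the independent energies
  \<open>max ((X j)\<^sup>2 / (2 h)) (2 c r (j + 1))\<close>, a deterministic inequality (Cauchy-Schwarz on each excursion)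
  bounds the area by \<open>3 E\<^sup>2 / (8 c ^ 3)\<close> up to lower order terms, where \<open>E\<close> is the total energy; and as
  \<open>N = o(sqrt u)\<close>, the energy exceeds \<open>x\<close> with probability \<open>exp (- x + o(sqrt u))\<close>.

  All estimates are made for a random walk on a grid of mesh \<open>h / m\<close>, uniformly in \<open>m\<close>, and passed to
  the limit \<open>m \<rightarrow> \<infinity>\<close> by Fatou's lemma.
\<close>

section \<open>The Lindley recursion\<close>

text \<open>The random walk with increments \<open>x\<close>, reflected at 0 and started empty at
  index \<open>a\<close>. The start index is a parameter so that the walk can be restarted at a
  block boundary.\<close>

primrec lindley :: "(nat \<Rightarrow> real) \<Rightarrow> nat \<Rightarrow> nat \<Rightarrow> real" where
  "lindley x a 0 = 0"
| "lindley x a (Suc k) = max 0 (lindley x a k + x (a + k))"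

lemma sum_lessThan_add:
  fixes f :: "nat \<Rightarrow> real"
  shows "(\<Sum>j<i+m. f j) = (\<Sum>j<i. f j) + (\<Sum>k<m. f (i + k))"
  by (induction m) auto

lemma lindley_nonneg: "0 \<le> lindley x a k"
  by (cases k) auto

lemma lindley_cong:
  assumes "\<And>i. a \<le> i \<Longrightarrow> i < a + k \<Longrightarrow> x i = y i"
  shows "lindley x a k = lindley y a k"
  using assms by (induction k) auto

text \<open>A reflected walk started from a level \<open>z\<close> is the maximum of
  \<open>z\<close> plus the free walk and the reflected walk started empty. This yields the
  recursion for the workload at block starts.\<close>

lemma lindley_add:
  "lindley x a (j + k) = max (lindley x a j + (\<Sum>i<k. x (a + j + i))) (lindley x (a + j) k)"
proof (induction k)
  case 0
  then show ?case using lindley_nonneg[of x a j] by simp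
next
  case (Suc k)
  then show ?case by (simp add: max_def add.assoc)
qed

lemma sum_le_lindley: "(\<Sum>i<k. x (a + i)) \<le> lindley x a k"
proof (induction k)
  case (Suc k)
  then show ?case by (simp add: max_def)
qed simp

lemma lindley_add_le: "lindley x a (j + k) \<le> lindley x a j + lindley x (a + j) k"
  unfolding lindley_add using sum_le_lindley[of x "a + j" k] lindley_nonneg[of x a j] by simp

text \<open>Together with \<open>lindley_increments_attained\<close>, this shows that the reflected
  walk is the maximum of \<open>w k - w j\<close> over \<open>j \<le> k\<close>, the discrete form
  of the supremum defining the workload.\<close>

lemma lindley_increments_ge:
  "j \<le> k \<Longrightarrow> w k - w j \<le> lindley (\<lambda>i. w (Suc i) - w i) 0 k"
proof (induction k)
  case (Suc k)
  then show ?case by (cases "j = Suc k") (auto simp: max_def)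
qed simp

lemma lindley_increments_attained:
  "\<exists>j\<le>k. lindley (\<lambda>i. w (Suc i) - w i) 0 k = w k - w j"
proof (induction k)
  case (Suc k)
  then obtain j where j: "j \<le> k" "lindley (\<lambda>i. w (Suc i) - w i) 0 k = w k - w j" by auto
  show ?case
  proof (cases "w (Suc k) - w j \<ge> 0")
    case True
    then show ?thesis using j by (intro exI[of _ j]) (auto simp: max_def)
  next
    case False
    then show ?thesis using j by (intro exI[of _ "Suc k"]) (auto simp: max_def)
  qed
qed simp

lemma borel_measurable_lindley:
  assumes "\<And>i. a \<le> i \<Longrightarrow> i < a + k \<Longrightarrow> (\<lambda>\<omega>. X i \<omega>) \<in> borel_measurable N"
  shows "(\<lambda>\<omega>. lindley (\<lambda>i. X i \<omega>) a k) \<in> borel_measurable N"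
  using assms by (induction k) auto

section \<open>Area against energy\<close>

text \<open>The left side bounds the area of an excursion of duration \<open>t\<close>, initial
  level \<open>\<rho>\<close> and energy \<open>e\<close>. AM-GM makes the root linear in
  \<open>e\<close> and leaves \<open>- c t^2 / 6\<close>; completing the square then removes
  \<open>t\<close>. For \<open>\<rho> = 0\<close> both steps are sharp at
  \<open>t = 3 e / (2 c^2)\<close>.\<close>

lemma area_le_energy_squared:
  fixes c e \<rho> t :: real
  assumes "c > 0" "e \<ge> 0" "t \<ge> 0"
  shows "t * \<rho> + sqrt (2 * e * t ^ 3 / 3) - c * t\<^sup>2 / 2 \<le> 3 / (8 * c ^ 3) * (e + 2 * c * \<rho>)\<^sup>2"
proof -
  have "sqrt (2 * e * t ^ 3 / 3) = t * sqrt ((e / c) * (2 * c * t / 3))"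
  proof -
    have "2 * e * t ^ 3 / 3 = t\<^sup>2 * ((e / c) * (2 * c * t / 3))"
      using assms by (simp add: power2_eq_square power3_eq_cube)
    then show ?thesis using assms by (simp only: real_sqrt_mult real_sqrt_abs abs_of_nonneg)
  qed
  also have "sqrt ((e / c) * (2 * c * t / 3)) \<le> (e / c + 2 * c * t / 3) / 2"
    using assms by (intro arith_geo_mean_sqrt) auto
  finally have "sqrt (2 * e * t ^ 3 / 3) \<le> t * ((e / c + 2 * c * t / 3) / 2)"
    using assms by (simp add: mult_left_mono)
  then have "t * \<rho> + sqrt (2 * e * t ^ 3 / 3) - c * t\<^sup>2 / 2 \<le> t * (\<rho> + e / (2 * c)) - c * t\<^sup>2 / 6"
  proof -
    have "t * ((e / c + 2 * c * t / 3) / 2) = t * e / (2 * c) + c * t\<^sup>2 / 3"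
      by (simp add: algebra_simps power2_eq_square add_divide_distrib)
    moreover have "t * (\<rho> + e / (2 * c)) = t * \<rho> + t * e / (2 * c)"
      by (simp add: algebra_simps)
    ultimately show ?thesis
      using \<open>sqrt (2 * e * t ^ 3 / 3) \<le> t * ((e / c + 2 * c * t / 3) / 2)\<close> by linarith
  qed
  also have "\<dots> \<le> 3 / (2 * c) * (\<rho> + e / (2 * c))\<^sup>2"
  proof -
    define z where "z = \<rho> + e / (2 * c)"
    have "3 / (2 * c) * z\<^sup>2 - (t * z - c * t\<^sup>2 / 6) = (3 * z - c * t)\<^sup>2 / (6 * c)"
      using assms by (simp add: field_simps power2_eq_square)
    moreover have "\<dots> \<ge> 0" using assms by simp
    ultimately show ?thesis unfolding z_def[symmetric] by linarith
  qed
  also have "\<dots> = 3 / (8 * c ^ 3) * (e + 2 * c * \<rho>)\<^sup>2"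
    using assms by (simp add: field_simps power2_eq_square power3_eq_cube)
  finally show ?thesis .
qed

lemma sum_squares_le_cube: "(\<Sum>l<n. (real l)\<^sup>2) \<le> real n ^ 3 / 3"
proof (induction n)
  case (Suc n)
  have "real n ^ 3 / 3 + (real n)\<^sup>2 \<le> real (Suc n) ^ 3 / 3"
    by (simp add: field_simps power2_eq_square power3_eq_cube)
  with Suc show ?case by simp
qed simp

lemma sum_partial_sums:
  fixes f :: "nat \<Rightarrow> real"
  shows "(\<Sum>k<n. \<Sum>l<k. f l) = (\<Sum>l<n. (real n - 1 - real l) * f l)"
proof (induction n)
  case (Suc n)
  have "(\<Sum>l<Suc n. (real (Suc n) - 1 - real l) * f l) = (\<Sum>l<n. (real n - real l) * f l)"
    by simp
  also have "\<dots> = (\<Sum>l<n. (real n - 1 - real l) * f l) + (\<Sum>l<n. f l)"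
    by (simp add: sum.distrib[symmetric] algebra_simps)
  finally show ?case using Suc by simp
qed simp

text \<open>The increment \<open>x l\<close> lifts the \<open>n - 1 - l\<close> later points, so the
  noise contributes a linear form whose squared coefficients sum to at most
  \<open>n ^ 3 / 3\<close>, and Cauchy-Schwarz applies. The extra \<open>c * h / 2\<close> arises
  because the drift sums to \<open>n (n - 1) / 2\<close> rather than
  \<open>n ^ 2 / 2\<close>.\<close>

lemma excursion_area_le:
  fixes x :: "nat \<Rightarrow> real"
  assumes "c > 0" "h > 0" "e \<ge> (\<Sum>l<n-1. (x l)\<^sup>2 / (2 * h))"
  shows "h * (\<Sum>k<n. \<rho> + (\<Sum>l<k. x l - c * h)) \<le> 3 / (8 * c ^ 3) * (e + 2 * c * (\<rho> + c * h / 2))\<^sup>2"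
proof -
  have e0: "e \<ge> 0"
    using assms by (intro order_trans[OF _ assms(3)] sum_nonneg) auto
  define t where "t = real n * h"
  have t0: "t \<ge> 0" using assms by (simp add: t_def)
  have "(\<Sum>k<n. \<rho> + (\<Sum>l<k. x l - c * h)) = real n * \<rho> + (\<Sum>k<n. \<Sum>l<k. x l) - c * h * (\<Sum>k<n. real k)"
    by (simp add: sum.distrib sum_subtractf sum_distrib_left mult.commute)
  also have "(\<Sum>k<n. real k) = real n * (real n - 1) / 2"
    by (induction n) (auto simp: field_simps)
  also have "h * (real n * \<rho> + (\<Sum>k<n. \<Sum>l<k. x l) - c * h * (real n * (real n - 1) / 2)) =
      t * (\<rho> + c * h / 2) + h * (\<Sum>k<n. \<Sum>l<k. x l) - c * t\<^sup>2 / 2"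
    by (simp add: t_def field_simps power2_eq_square)
  finally have eq: "h * (\<Sum>k<n. \<rho> + (\<Sum>l<k. x l - c * h)) =
      t * (\<rho> + c * h / 2) + h * (\<Sum>k<n. \<Sum>l<k. x l) - c * t\<^sup>2 / 2" .
  have "h * (\<Sum>k<n. \<Sum>l<k. x l) \<le> sqrt (2 * e * t ^ 3 / 3)"
  proof (rule real_le_rsqrt)
    \<comment> \<open>The increment with index \<open>n - 1\<close> has coefficient 0, so only the
      first \<open>n - 1\<close> increments are charged.\<close>
    have "(\<Sum>k<n. \<Sum>l<k. x l) = (\<Sum>l<n-1. (real n - 1 - real l) * x l)"
      unfolding sum_partial_sums by (cases n) auto
    then have "(\<Sum>k<n. \<Sum>l<k. x l)\<^sup>2 \<le> (\<Sum>l<n-1. (real n - 1 - real l)\<^sup>2) * (\<Sum>l<n-1. (x l)\<^sup>2)"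
      using Cauchy_Schwarz_ineq_sum[of "\<lambda>l. real n - 1 - real l" x "{..<n-1}"] by simp
    also have "\<dots> \<le> (real n ^ 3 / 3) * (2 * h * e)"
    proof (rule mult_mono)
      have "(\<Sum>l<n-1. (real n - 1 - real l)\<^sup>2) = (\<Sum>l<n-1. (real (Suc l))\<^sup>2)"
        by (subst sum.nat_diff_reindex[symmetric], rule sum.cong) (auto simp: of_nat_diff)
      also have "\<dots> \<le> (\<Sum>l<Suc (n-1). (real l)\<^sup>2)"
        by (subst sum.lessThan_Suc_shift) simp
      also have "\<dots> \<le> (\<Sum>l<n. (real l)\<^sup>2)"
        by (cases n) auto
      also have "\<dots> \<le> real n ^ 3 / 3" by (rule sum_squares_le_cube)
      finally show "(\<Sum>l<n-1. (real n - 1 - real l)\<^sup>2) \<le> real n ^ 3 / 3" .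
      show "(\<Sum>l<n-1. (x l)\<^sup>2) \<le> 2 * h * e"
        using assms by (simp add: sum_divide_distrib[symmetric] field_simps)
    qed (auto intro: sum_nonneg)
    finally have "h\<^sup>2 * (\<Sum>k<n. \<Sum>l<k. x l)\<^sup>2 \<le> h\<^sup>2 * ((real n ^ 3 / 3) * (2 * h * e))"
      by (intro mult_left_mono) auto
    then show "(h * (\<Sum>k<n. \<Sum>l<k. x l))\<^sup>2 \<le> 2 * e * t ^ 3 / 3"
      by (simp add: t_def power_mult_distrib power2_eq_square power3_eq_cube mult_ac)
  qed
  with eq area_le_energy_squared[OF \<open>c > 0\<close> e0 t0, of "\<rho> + c * h / 2"] show ?thesis by linarith
qed

text \<open>The path is cut at the times \<open>j\<close> with \<open>Q j = r j\<close>; between them it is a random walk, and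
  the excursions are combined using superadditivity of the square.\<close>

lemma area_le_energy:
  fixes Q X r e :: "nat \<Rightarrow> real"
  assumes c: "c > 0" and h: "h > 0"
    and Q0: "Q 0 = r 0" and QS: "\<And>j. Q (Suc j) = max (Q j + X j - c * h) (r (Suc j))"
    and r: "\<And>j. r j \<ge> 0"
    and er: "\<And>j. e j \<ge> 2 * c * r j" and eX: "\<And>j. e (Suc j) \<ge> (X j)\<^sup>2 / (2 * h)"
  shows "h * (\<Sum>j<n. Q j) \<le> 3 / (8 * c ^ 3) * ((\<Sum>j<n. e j)\<^sup>2 + 10 * c\<^sup>2 * h * (\<Sum>j<n. e j))"
proof (induction n rule: less_induct)
  case (less n)
  have Qr: "Q j \<ge> r j" for j by (cases j) (auto simp: Q0 QS)
  have Qpos: "Q j \<ge> 0" for j using Qr[of j] r[of j] by simp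
  have epos: "e j \<ge> 0" for j using er[of j] r[of j] c by (smt (verit) mult_nonneg_nonneg)
  show ?case
  proof (cases "n = 0")
    case False
    \<comment> \<open>\<open>i\<close> is the last regeneration before \<open>n\<close>. The
      induction hypothesis handles the points before \<open>i\<close>; those from \<open>i\<close>
      on form a single excursion.\<close>
    define i where "i = (GREATEST i. i < n \<and> Q i = r i)"
    have ex: "\<exists>i. i < n \<and> Q i = r i" using False Q0 by auto
    have i: "i < n" "Q i = r i"
      using GreatestI_ex_nat[OF ex, of n] unfolding i_def by auto
    have imax: "Q j \<noteq> r j" if "i < j" "j < n" for j
      using Greatest_le_nat[of "\<lambda>i. i < n \<and> Q i = r i" j n] that unfolding i_def by auto
    have step: "Q (i + k) = r i + (\<Sum>l<k. X (i + l) - c * h)" if "i + k < n" for k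
      using that
    proof (induction k)
      case (Suc k)
      have "Q (Suc (i + k)) = Q (i + k) + X (i + k) - c * h"
        using imax[of "Suc (i + k)"] Suc.prems QS[of "i + k"] by (auto simp: max_def split: if_splits)
      with Suc show ?case by simp
    qed (simp add: i)
    define m where "m = n - i"
    have m: "n = i + m" "m > 0" using i by (auto simp: m_def)
    define E where "E = (\<Sum>k<m. e (i + k))"
    have E0: "E \<ge> 0" unfolding E_def by (intro sum_nonneg epos)
    have Edec: "E = e i + (\<Sum>k<m-1. e (Suc (i + k)))"
      unfolding E_def using m by (cases m) (auto simp: sum.lessThan_Suc_shift simp del: sum.lessThan_Suc)
    have area: "h * (\<Sum>k<m. Q (i + k)) \<le> 3 / (8 * c ^ 3) * (E\<^sup>2 + 10 * c\<^sup>2 * h * E)"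
    \<comment> \<open>A one-point excursion charges no increment, so its energy need not be
      comparable to \<open>c^2 h\<close>; its area \<open>h * r i\<close> is absorbed by the linear
      term.\<close>
    proof (cases "m = 1")
      case True
      have "h * r i \<le> 3 / (8 * c ^ 3) * (10 * c\<^sup>2 * h * E)"
      proof -
        have "h * r i \<le> h * (E / (2 * c))"
          using er[of i] True c h by (intro mult_left_mono) (auto simp: E_def field_simps)
        also have "\<dots> \<le> 3 / (8 * c ^ 3) * (10 * c\<^sup>2 * h * E)"
          using c h E0 by (simp add: field_simps power2_eq_square power3_eq_cube)
        finally show ?thesis .
      qed
      also have "\<dots> \<le> 3 / (8 * c ^ 3) * (E\<^sup>2 + 10 * c\<^sup>2 * h * E)"
        using c by (intro mult_left_mono) auto
      finally show ?thesis using True i by simp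
    next
      case False
      then have m2: "m \<ge> 2" using m by simp
      have "h * (\<Sum>k<m. Q (i + k)) = h * (\<Sum>k<m. r i + (\<Sum>l<k. X (i + l) - c * h))"
        using step m by (intro arg_cong[where f = "\<lambda>z. h * z"] sum.cong) auto
      \<comment> \<open>The entry \<open>e i \<ge> 2 c r i\<close> pays for the initial level and
        the other entries pay for the increments; the two parts recombine to \<open>E\<close>, up to
        the mesh correction \<open>c^2 h\<close>.\<close>
      also have "\<dots> \<le> 3 / (8 * c ^ 3) * ((E - 2 * c * r i) + 2 * c * (r i + c * h / 2))\<^sup>2"
      proof (intro excursion_area_le c h)
        have "(\<Sum>l<m-1. (X (i + l))\<^sup>2 / (2 * h)) \<le> (\<Sum>k<m-1. e (Suc (i + k)))"
          by (intro sum_mono eX)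
        then show "(\<Sum>l<m-1. (X (i + l))\<^sup>2 / (2 * h)) \<le> E - 2 * c * r i"
          unfolding Edec using er[of i] by linarith
      qed
      also have "(E - 2 * c * r i) + 2 * c * (r i + c * h / 2) = E + c\<^sup>2 * h"
        by (simp add: algebra_simps power2_eq_square)
      \<comment> \<open>Expanding the square gives \<open>2 c^2 h E + (c^2 h)^2\<close> beyond
        \<open>E^2\<close>, so \<open>c^2 h \<le> 8 E\<close> suffices. To stay nonnegative after
        one step, the initial level or the first increment must be at least \<open>c h / 2\<close>,
        and either carries energy at least \<open>c^2 h / 8\<close>.\<close>
      also have "(E + c\<^sup>2 * h)\<^sup>2 \<le> E\<^sup>2 + 10 * c\<^sup>2 * h * E"
      proof -
        have "c\<^sup>2 * h \<le> 8 * E"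
        proof -
          have Ege: "E \<ge> e i + e (Suc i)"
          proof -
            have "(\<Sum>k\<in>{0}. e (Suc (i + k))) \<le> (\<Sum>k<m-1. e (Suc (i + k)))"
              using m2 by (intro sum_mono2) (auto intro: epos)
            then show ?thesis unfolding Edec by simp
          qed
          have "Q (i + 1) = r i + (X i - c * h)" using step[of 1] m m2 by simp
          then have "r i + X i \<ge> c * h" using Qpos[of "i + 1"] by simp
          then consider "r i \<ge> c * h / 2" | "X i \<ge> c * h / 2" by linarith
          then show ?thesis
          proof cases
            case 1
            then have "2 * c * r i \<ge> 2 * c * (c * h / 2)" using c by (intro mult_left_mono) auto
            then have "c\<^sup>2 * h \<le> e i" using er[of i] by (simp add: power2_eq_square mult_ac)
            then show ?thesis using Ege epos[of "Suc i"] E0 epos[of i] by linarith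
          next
            case 2
            then have "(X i)\<^sup>2 \<ge> (c * h / 2)\<^sup>2" using c h by (intro power_mono) auto
            then have "(X i)\<^sup>2 / (2 * h) \<ge> (c * h / 2)\<^sup>2 / (2 * h)" using h by (intro divide_right_mono) auto
            also have "(c * h / 2)\<^sup>2 / (2 * h) = c\<^sup>2 * h / 8" using h by (simp add: power2_eq_square)
            finally show ?thesis using eX[of i] Ege epos[of i] by linarith
          qed
        qed
        then have "c\<^sup>2 * h * (c\<^sup>2 * h) \<le> c\<^sup>2 * h * (8 * E)"
          using c h by (intro mult_left_mono) auto
        then show ?thesis by (simp add: power2_eq_square algebra_simps)
      qed
      finally show ?thesis using c by (simp add: mult_left_mono divide_right_mono)
    qed
    define D where "D = (\<Sum>j<i. e j)"
    have D0: "D \<ge> 0" unfolding D_def by (intro sum_nonneg epos)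
    note split = sum_lessThan_add[of _ i m, folded m(1)]
    have "h * (\<Sum>j<n. Q j) \<le> 3 / (8 * c ^ 3) * (D\<^sup>2 + 10 * c\<^sup>2 * h * D) + 3 / (8 * c ^ 3) * (E\<^sup>2 + 10 * c\<^sup>2 * h * E)"
      using less.IH[OF i(1)] area unfolding split[of Q] D_def by (simp add: distrib_left)
    also have "\<dots> = 3 / (8 * c ^ 3) * ((D\<^sup>2 + E\<^sup>2) + 10 * c\<^sup>2 * h * (D + E))"
      by (simp add: algebra_simps)
    also have "\<dots> \<le> 3 / (8 * c ^ 3) * ((D + E)\<^sup>2 + 10 * c\<^sup>2 * h * (D + E))"
      using c D0 E0 by (intro mult_left_mono add_right_mono) (auto simp: power2_sum)
    finally show ?thesis unfolding split[of e] D_def E_def .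
  qed simp
qed

section \<open>Exponential tail bounds\<close>

context prob_space
begin

text \<open>Conditioning on \<open>Z = y\<close> leaves the tail of \<open>L\<close> at
  \<open>x - y\<close>, and averaging \<open>exp (lam * y)\<close> costs a factor at most 1. An
  exponential tail thus survives an independent increment.\<close>

lemma prob_add_ge_le_exp:
  fixes L Z :: "'a \<Rightarrow> real"
  assumes ind: "indep_var borel L borel Z"
    and L: "\<And>y. prob {\<omega> \<in> space M. y \<le> L \<omega>} \<le> exp (- lam * y)"
    and Z: "(\<integral>\<^sup>+\<omega>. ennreal (exp (lam * Z \<omega>)) \<partial>M) \<le> 1"
  shows "prob {\<omega> \<in> space M. x \<le> L \<omega> + Z \<omega>} \<le> exp (- lam * x)"
proof -
  have [measurable]: "random_variable borel L" "random_variable borel Z"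
    using ind by (auto dest: indep_var_rv1 indep_var_rv2)
  interpret L: prob_space "distr M borel L" by (rule prob_space_distr) simp
  interpret Z: prob_space "distr M borel Z" by (rule prob_space_distr) simp
  interpret LZ: pair_sigma_finite "distr M borel L" "distr M borel Z" ..
  let ?A = "{p \<in> space (borel \<Otimes>\<^sub>M borel). x \<le> fst p + snd p} :: (real \<times> real) set"
  have A: "?A \<in> sets (borel \<Otimes>\<^sub>M borel)" by measurable
  have "emeasure M {\<omega> \<in> space M. x \<le> L \<omega> + Z \<omega>} =
      emeasure (distr M (borel \<Otimes>\<^sub>M borel) (\<lambda>\<omega>. (L \<omega>, Z \<omega>))) ?A"
    by (subst emeasure_distr[OF _ A])
       (auto intro!: arg_cong[where f = "emeasure M"] simp: space_pair_measure)
  also have "\<dots> = emeasure (distr M borel L \<Otimes>\<^sub>M distr M borel Z) ?A"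
    using ind unfolding indep_var_distribution_eq by simp
  also have "\<dots> = (\<integral>\<^sup>+y. emeasure (distr M borel L) ((\<lambda>l. (l, y)) -` ?A) \<partial>distr M borel Z)"
    by (subst LZ.emeasure_pair_measure_alt2) (use A in auto)
  also have "\<dots> \<le> (\<integral>\<^sup>+y. ennreal (exp (- lam * x)) * ennreal (exp (lam * y)) \<partial>distr M borel Z)"
  proof (rule nn_integral_mono)
    fix y :: real
    have "emeasure (distr M borel L) ((\<lambda>l. (l, y)) -` ?A) = emeasure (distr M borel L) {x - y..}"
      by (intro arg_cong[where f = "emeasure (distr M borel L)"]) (auto simp: space_pair_measure)
    also have "\<dots> = emeasure M {\<omega> \<in> space M. x - y \<le> L \<omega>}"
      by (subst emeasure_distr) (auto intro!: arg_cong[where f = "emeasure M"])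
    also have "\<dots> \<le> ennreal (exp (- lam * (x - y)))"
      using L[of "x - y"] by (simp add: emeasure_eq_measure)
    finally show "emeasure (distr M borel L) ((\<lambda>l. (l, y)) -` ?A) \<le>
        ennreal (exp (- lam * x)) * ennreal (exp (lam * y))"
      by (simp add: ennreal_mult[symmetric] exp_add[symmetric] algebra_simps)
  qed
  also have "\<dots> = ennreal (exp (- lam * x)) * (\<integral>\<^sup>+\<omega>. ennreal (exp (lam * Z \<omega>)) \<partial>M)"
    by (subst nn_integral_cmult) (auto simp: nn_integral_distr)
  also have "\<dots> \<le> ennreal (exp (- lam * x)) * 1"
    by (intro mult_left_mono Z) auto
  finally show ?thesis by (simp add: emeasure_eq_measure)
qed

text \<open>Kingman's bound, by induction on the number of steps: for \<open>x > 0\<close> the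
  reflection does not affect the event, so the previous lemma applies; for \<open>x \<le> 0\<close>
  the right side is at least 1. The bound is free of \<open>k\<close>.\<close>

lemma prob_lindley_ge_le:
  fixes X :: "nat \<Rightarrow> 'a \<Rightarrow> real"
  assumes ind: "indep_vars (\<lambda>_. borel) X {..<n}"
    and lam: "lam > 0"
    and E: "\<And>i. i < n \<Longrightarrow> (\<integral>\<^sup>+\<omega>. ennreal (exp (lam * X i \<omega>)) \<partial>M) \<le> 1"
    and k: "a + k \<le> n"
  shows "prob {\<omega> \<in> space M. x \<le> lindley (\<lambda>i. X i \<omega>) a k} \<le> exp (- lam * x)"
  using k
proof (induction k arbitrary: x)
  case 0
  show ?case
  proof (cases "x \<le> 0")
    case True
    then have "- lam * x \<ge> 0" using lam by (simp add: mult_nonneg_nonpos)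
    then have "1 \<le> exp (- lam * x)" by simp
    then show ?thesis by (rule order_trans[OF prob_le_1])
  qed simp
next
  case (Suc k)
  show ?case
  proof (cases "x \<le> 0")
    case True
    then have "- lam * x \<ge> 0" using lam by (simp add: mult_nonneg_nonpos)
    then have "1 \<le> exp (- lam * x)" by simp
    then show ?thesis by (rule order_trans[OF prob_le_1])
  next
    case False
    have "indep_var borel ((\<lambda>f. lindley f a k) \<circ> (\<lambda>\<omega>. restrict (\<lambda>i. X i \<omega>) {a..<a+k}))
        borel ((\<lambda>f. f (a + k)) \<circ> (\<lambda>\<omega>. restrict (\<lambda>i. X i \<omega>) {a + k}))"
      using Suc.prems
      by (intro indep_var_compose[OF indep_var_restrict[OF ind]])
         (auto intro!: borel_measurable_lindley measurable_component_singleton)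
    also have "(\<lambda>f. lindley f a k) \<circ> (\<lambda>\<omega>. restrict (\<lambda>i. X i \<omega>) {a..<a+k}) =
        (\<lambda>\<omega>. lindley (\<lambda>i. X i \<omega>) a k)"
      by (auto simp: fun_eq_iff intro!: lindley_cong)
    also have "(\<lambda>f. f (a + k)) \<circ> (\<lambda>\<omega>. restrict (\<lambda>i. X i \<omega>) {a + k}) = X (a + k)"
      by auto
    finally have "prob {\<omega> \<in> space M. x \<le> lindley (\<lambda>i. X i \<omega>) a k + X (a + k) \<omega>} \<le> exp (- lam * x)"
      using Suc E by (intro prob_add_ge_le_exp) auto
    also have "{\<omega> \<in> space M. x \<le> lindley (\<lambda>i. X i \<omega>) a k + X (a + k) \<omega>} =
        {\<omega> \<in> space M. x \<le> lindley (\<lambda>i. X i \<omega>) a (Suc k)}"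
      using False by auto
    finally show ?thesis .
  qed
qed

text \<open>Splitting by the integer part of \<open>Y\<close> compares the moment with a geometric
  series of ratio \<open>exp (\<theta> - 1)\<close>.\<close>

lemma nn_integral_exp_le_of_tail:
  fixes Y :: "'a \<Rightarrow> real"
  assumes [measurable]: "random_variable borel Y"
    and nonneg: "\<And>\<omega>. \<omega> \<in> space M \<Longrightarrow> Y \<omega> \<ge> 0"
    and tail: "\<And>k::nat. prob {\<omega> \<in> space M. real k \<le> Y \<omega>} \<le> exp (- real k)"
    and \<theta>: "0 \<le> \<theta>" "\<theta> < 1"
  shows "(\<integral>\<^sup>+\<omega>. ennreal (exp (\<theta> * Y \<omega>)) \<partial>M) \<le> ennreal (exp \<theta> / (1 - exp (\<theta> - 1)))"
proof -
  let ?A = "\<lambda>k::nat. {\<omega> \<in> space M. real k \<le> Y \<omega>}"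
  have "(\<integral>\<^sup>+\<omega>. ennreal (exp (\<theta> * Y \<omega>)) \<partial>M) \<le>
      (\<integral>\<^sup>+\<omega>. (\<Sum>k. ennreal (exp (\<theta> * (real k + 1))) * indicator (?A k) \<omega>) \<partial>M)"
  proof (rule nn_integral_mono)
    fix \<omega> assume \<omega>: "\<omega> \<in> space M"
    define k where "k = nat \<lfloor>Y \<omega>\<rfloor>"
    have k: "real k \<le> Y \<omega>" "Y \<omega> \<le> real k + 1" using nonneg[OF \<omega>] unfolding k_def by linarith+
    have "ennreal (exp (\<theta> * Y \<omega>)) \<le> ennreal (exp (\<theta> * (real k + 1)))"
      using k \<theta> by (intro ennreal_leI) (simp add: mult_left_mono)
    also have "\<dots> = (\<Sum>i\<in>{k}. ennreal (exp (\<theta> * (real i + 1))) * indicator (?A i) \<omega>)"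
      using k \<omega> by simp
    also have "\<dots> \<le> (\<Sum>i. ennreal (exp (\<theta> * (real i + 1))) * indicator (?A i) \<omega>)"
      by (rule sum_le_suminf) auto
    finally show "ennreal (exp (\<theta> * Y \<omega>)) \<le> \<dots>" .
  qed
  also have "\<dots> = (\<Sum>k. ennreal (exp (\<theta> * (real k + 1))) * emeasure M (?A k))"
    by (subst nn_integral_suminf) (auto simp: nn_integral_cmult_indicator)
  also have "\<dots> \<le> (\<Sum>k. ennreal (exp \<theta> * exp (\<theta> - 1) ^ k))"
  proof (rule suminf_le)
    fix k
    have "ennreal (exp (\<theta> * (real k + 1))) * emeasure M (?A k) \<le>
        ennreal (exp (\<theta> * (real k + 1))) * ennreal (exp (- real k))"
      using tail[of k] by (intro mult_left_mono) (auto simp: emeasure_eq_measure)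
    also have "\<dots> = ennreal (exp \<theta> * exp (\<theta> - 1) ^ k)"
      by (simp add: ennreal_mult[symmetric] exp_of_nat_mult[symmetric] exp_add[symmetric] algebra_simps)
    finally show "ennreal (exp (\<theta> * (real k + 1))) * emeasure M (?A k) \<le> \<dots>" .
  qed auto
  also have "\<dots> = ennreal (exp \<theta> / (1 - exp (\<theta> - 1)))"
  proof (rule suminf_ennreal_eq)
    have "(\<lambda>k. exp \<theta> * exp (\<theta> - 1) ^ k) sums (exp \<theta> * (1 / (1 - exp (\<theta> - 1))))"
      using \<theta> by (intro sums_mult geometric_sums) auto
    then show "(\<lambda>k. exp \<theta> * exp (\<theta> - 1) ^ k) sums (exp \<theta> / (1 - exp (\<theta> - 1)))" by simp
  qed auto
  finally show ?thesis .
qed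

text \<open>Chernoff's bound: Markov's inequality for the exponential of the sum, whose expectation
  factorises by independence.\<close>

lemma prob_sum_ge_le:
  fixes Z :: "nat \<Rightarrow> 'a \<Rightarrow> real"
  assumes ind: "indep_vars (\<lambda>_. borel) Z {..<N}"
    and E: "\<And>j. j < N \<Longrightarrow> (\<integral>\<^sup>+\<omega>. ennreal (exp (\<theta> * Z j \<omega>)) \<partial>M) \<le> ennreal C"
    and \<theta>: "\<theta> \<ge> 0" and C: "C \<ge> 0"
  shows "prob {\<omega> \<in> space M. x \<le> (\<Sum>j<N. Z j \<omega>)} \<le> C ^ N * exp (- \<theta> * x)"
proof -
  have [measurable]: "random_variable borel (Z j)" if "j < N" for j
    using ind that by (auto simp: indep_vars_def)
  let ?A = "{\<omega> \<in> space M. x \<le> (\<Sum>j<N. Z j \<omega>)}"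
  have A: "?A \<in> events" by measurable
  have "emeasure M ?A = (\<integral>\<^sup>+\<omega>. indicator ?A \<omega> \<partial>M)"
    using A by simp
  also have "\<dots> \<le> (\<integral>\<^sup>+\<omega>. ennreal (exp (- \<theta> * x)) * (\<Prod>j<N. ennreal (exp (\<theta> * Z j \<omega>))) \<partial>M)"
  proof (rule nn_integral_mono)
    fix \<omega>
    have "ennreal (exp (- \<theta> * x)) * (\<Prod>j<N. ennreal (exp (\<theta> * Z j \<omega>))) =
        ennreal (exp (\<theta> * ((\<Sum>j<N. Z j \<omega>) - x)))"
      by (simp add: prod_ennreal ennreal_mult[symmetric] exp_sum[symmetric] exp_add[symmetric]
          sum_distrib_left algebra_simps)
    moreover have "1 \<le> ennreal (exp (\<theta> * ((\<Sum>j<N. Z j \<omega>) - x)))" if "\<omega> \<in> ?A"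
      using that \<theta> by (auto intro!: mult_nonneg_nonneg)
    ultimately show "indicator ?A \<omega> \<le> ennreal (exp (- \<theta> * x)) * (\<Prod>j<N. ennreal (exp (\<theta> * Z j \<omega>)))"
      by (auto split: split_indicator)
  qed
  also have "\<dots> = ennreal (exp (- \<theta> * x)) * (\<integral>\<^sup>+\<omega>. (\<Prod>j<N. ennreal (exp (\<theta> * Z j \<omega>))) \<partial>M)"
    by (intro nn_integral_cmult) measurable
  also have "(\<integral>\<^sup>+\<omega>. (\<Prod>j<N. ennreal (exp (\<theta> * Z j \<omega>))) \<partial>M) =
      (\<Prod>j<N. \<integral>\<^sup>+\<omega>. ennreal (exp (\<theta> * Z j \<omega>)) \<partial>M)"
    by (intro indep_vars_nn_integral indep_vars_compose2[OF ind]) auto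
  also have "\<dots> \<le> (\<Prod>j<N. ennreal C)"
    by (intro prod_mono_ennreal) (auto intro: E)
  also have "(\<Prod>j<N. ennreal C) = ennreal (C ^ N)"
    using C by (simp add: ennreal_power)
  finally have "emeasure M ?A \<le> ennreal (exp (- \<theta> * x)) * ennreal (C ^ N)"
    by (simp add: mult_left_mono)
  then show ?thesis
    using C by (simp add: emeasure_eq_measure ennreal_mult[symmetric] mult.commute)
qed

text \<open>\<open>f_cong\<close> says that \<open>f j\<close> reads only the coordinates in
  \<open>K j\<close>. This lets functionals of whole sequences, such as \<open>energy\<close>, be
  used without explicit restrictions.\<close>

lemma indep_vars_functions_of_blocks:
  fixes X :: "'i \<Rightarrow> 'a \<Rightarrow> real" and f :: "'j \<Rightarrow> ('i \<Rightarrow> real) \<Rightarrow> real"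
  assumes ind: "indep_vars (\<lambda>_. borel) X I"
    and K: "\<And>j. j \<in> J \<Longrightarrow> K j \<subseteq> I" "disjoint_family_on K J"
    and f: "\<And>j. j \<in> J \<Longrightarrow> f j \<in> borel_measurable (PiM (K j) (\<lambda>_. borel))"
    and f_cong: "\<And>j g. j \<in> J \<Longrightarrow> f j (restrict g (K j)) = f j g"
  shows "indep_vars (\<lambda>_. borel) (\<lambda>j \<omega>. f j (\<lambda>i. X i \<omega>)) J"
proof -
  have "indep_vars (\<lambda>_. borel) (\<lambda>j \<omega>. f j (restrict (\<lambda>i. X i \<omega>) (K j))) J"
    using indep_vars_restrict[OF ind K] f by (rule indep_vars_compose2)
  then show ?thesis
    by (rule iffD1[OF indep_vars_cong, rotated -1]) (auto simp: f_cong)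
qed

end

text \<open>The exponential factor turns the density into \<open>1 / sqrt (1 - \<theta>)\<close>
  times that of a normal law with deviation \<open>\<sigma> / sqrt (1 - \<theta>)\<close>. Hence a
  Gaussian energy has exponential moments of every order below 1.\<close>

lemma nn_integral_normal_exp_square:
  assumes \<sigma>: "\<sigma> > 0" and \<theta>: "\<theta> < 1"
    and X: "distributed M lborel X (normal_density 0 \<sigma>)"
  shows "(\<integral>\<^sup>+\<omega>. ennreal (exp (\<theta> * ((X \<omega>)\<^sup>2 / (2 * \<sigma>\<^sup>2)))) \<partial>M) = ennreal (1 / sqrt (1 - \<theta>))"
proof -
  let ?s = "sqrt (1 - \<theta>)"
  have s: "?s > 0" "?s\<^sup>2 = 1 - \<theta>" using \<theta> by auto
  have "(\<integral>\<^sup>+\<omega>. ennreal (exp (\<theta> * ((X \<omega>)\<^sup>2 / (2 * \<sigma>\<^sup>2)))) \<partial>M) =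
      (\<integral>\<^sup>+x. ennreal (normal_density 0 \<sigma> x) * ennreal (exp (\<theta> * (x\<^sup>2 / (2 * \<sigma>\<^sup>2)))) \<partial>lborel)"
    by (rule distributed_nn_integral[OF X, symmetric]) auto
  also have "\<dots> = (\<integral>\<^sup>+x. ennreal (1 / ?s) * ennreal (normal_density 0 (\<sigma> / ?s) x) \<partial>lborel)"
  proof (rule nn_integral_cong)
    fix x :: real
    have "normal_density 0 \<sigma> x * exp (\<theta> * (x\<^sup>2 / (2 * \<sigma>\<^sup>2))) = 1 / ?s * normal_density 0 (\<sigma> / ?s) x"
    proof -
      have "sqrt (2 * pi * (\<sigma> / ?s)\<^sup>2) = sqrt (2 * pi * \<sigma>\<^sup>2) / ?s"
        using s \<theta> by (simp add: power_divide real_sqrt_divide real_sqrt_mult)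
      moreover have "- x\<^sup>2 / (2 * (\<sigma> / ?s)\<^sup>2) = - x\<^sup>2 / (2 * \<sigma>\<^sup>2) + \<theta> * (x\<^sup>2 / (2 * \<sigma>\<^sup>2))"
        using \<sigma> \<theta> by (simp add: power_divide field_simps)
      ultimately show ?thesis
        using s \<theta> by (simp add: normal_density_def exp_add[symmetric])
    qed
    then show "ennreal (normal_density 0 \<sigma> x) * ennreal (exp (\<theta> * (x\<^sup>2 / (2 * \<sigma>\<^sup>2)))) =
        ennreal (1 / ?s) * ennreal (normal_density 0 (\<sigma> / ?s) x)"
      using s \<theta> by (simp add: ennreal_mult[symmetric])
  qed
  also have "\<dots> = ennreal (1 / ?s)"
    using \<sigma> s by (subst nn_integral_cmult) (auto simp: nn_integral_eq_integral)
  finally show ?thesis .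
qed

text \<open>Exponential tilting: the factor moves the mean of the normal law from 0 to
  \<open>a * \<sigma>\<^sup>2\<close>.\<close>

lemma nn_integral_normal_exp:
  assumes \<sigma>: "\<sigma> > 0"
    and X: "distributed M lborel X (normal_density 0 \<sigma>)"
  shows "(\<integral>\<^sup>+\<omega>. ennreal (exp (a * X \<omega> - a\<^sup>2 * \<sigma>\<^sup>2 / 2)) \<partial>M) = 1"
proof -
  have "(\<integral>\<^sup>+\<omega>. ennreal (exp (a * X \<omega> - a\<^sup>2 * \<sigma>\<^sup>2 / 2)) \<partial>M) =
      (\<integral>\<^sup>+x. ennreal (normal_density 0 \<sigma> x) * ennreal (exp (a * x - a\<^sup>2 * \<sigma>\<^sup>2 / 2)) \<partial>lborel)"
    by (rule distributed_nn_integral[OF X, symmetric]) auto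
  also have "\<dots> = (\<integral>\<^sup>+x. ennreal (normal_density (a * \<sigma>\<^sup>2) \<sigma> x) \<partial>lborel)"
  proof (rule nn_integral_cong)
    fix x :: real
    have "- (x - a * \<sigma>\<^sup>2)\<^sup>2 / (2 * \<sigma>\<^sup>2) = - x\<^sup>2 / (2 * \<sigma>\<^sup>2) + (a * x - a\<^sup>2 * \<sigma>\<^sup>2 / 2)"
      using \<sigma> by (simp add: field_simps power2_eq_square)
    then have "normal_density 0 \<sigma> x * exp (a * x - a\<^sup>2 * \<sigma>\<^sup>2 / 2) = normal_density (a * \<sigma>\<^sup>2) \<sigma> x"
      by (simp add: normal_density_def exp_add[symmetric])
    then show "ennreal (normal_density 0 \<sigma> x) * ennreal (exp (a * x - a\<^sup>2 * \<sigma>\<^sup>2 / 2)) =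
        ennreal (normal_density (a * \<sigma>\<^sup>2) \<sigma> x)"
      by (simp add: ennreal_mult[symmetric])
  qed
  also have "\<dots> = 1"
    using \<sigma> by (simp add: nn_integral_eq_integral)
  finally show ?thesis .
qed

text \<open>The density on \<open>[y, y + \<sigma>]\<close> is at least its value at the right end,
  and the length \<open>\<sigma>\<close> cancels the normalising factor. The lower bound
  \<open>s\<close> on the deviation makes the estimate uniform when \<open>\<sigma>\<close> varies
  with the mesh.\<close>

lemma (in prob_space) prob_normal_ge:
  assumes \<sigma>: "\<sigma> > 0" "\<sigma> \<ge> s" "s > 0" and y: "y \<ge> 0"
    and X: "distributed M lborel X (normal_density 0 \<sigma>)"
  shows "prob {\<omega> \<in> space M. y \<le> X \<omega>} \<ge> exp (- (y / s + 1)\<^sup>2 / 2) / sqrt (2 * pi)"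
proof -
  have [measurable]: "random_variable borel X" using X by (simp add: distributed_def)
  have "ennreal (exp (- (y / s + 1)\<^sup>2 / 2) / sqrt (2 * pi)) =
      (\<integral>\<^sup>+x. ennreal (exp (- (y / s + 1)\<^sup>2 / 2) / sqrt (2 * pi) / \<sigma>) * indicator {y..y+\<sigma>} x \<partial>lborel)"
    using \<sigma> by (simp add: nn_integral_cmult_indicator ennreal_mult[symmetric])
  also have "\<dots> \<le> (\<integral>\<^sup>+x. ennreal (normal_density 0 \<sigma> x) * indicator {y..} x \<partial>lborel)"
  proof (rule nn_integral_mono)
    fix x :: real
    have "exp (- (y / s + 1)\<^sup>2 / 2) / sqrt (2 * pi) / \<sigma> \<le> normal_density 0 \<sigma> x" if "x \<in> {y..y+\<sigma>}"
    proof -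
      have "x / \<sigma> \<le> y / \<sigma> + 1" using that \<sigma> by (simp add: field_simps)
      also have "\<dots> \<le> y / s + 1" using \<sigma> y by (simp add: divide_left_mono)
      finally have "(x / \<sigma>)\<^sup>2 \<le> (y / s + 1)\<^sup>2" using that y \<sigma> by (intro power_mono) auto
      then have "exp (- (y / s + 1)\<^sup>2 / 2) \<le> exp (- (x / \<sigma>)\<^sup>2 / 2)" by simp
      then have "exp (- (y / s + 1)\<^sup>2 / 2) / sqrt (2 * pi) / \<sigma> \<le> exp (- (x / \<sigma>)\<^sup>2 / 2) / sqrt (2 * pi) / \<sigma>"
        using \<sigma> by (intro divide_right_mono) auto
      also have "\<dots> = normal_density 0 \<sigma> x"
        using \<sigma> by (simp add: normal_density_def power_divide real_sqrt_mult)
      finally show ?thesis .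
    qed
    then show "ennreal (exp (- (y / s + 1)\<^sup>2 / 2) / sqrt (2 * pi) / \<sigma>) * indicator {y..y+\<sigma>} x \<le>
        ennreal (normal_density 0 \<sigma> x) * indicator {y..} x"
      by (auto split: split_indicator intro: ennreal_leI)
  qed
  also have "\<dots> = (\<integral>\<^sup>+\<omega>. indicator {y..} (X \<omega>) \<partial>M)"
    by (rule distributed_nn_integral[OF X]) auto
  also have "\<dots> = (\<integral>\<^sup>+\<omega>. indicator {\<omega> \<in> space M. y \<le> X \<omega>} \<omega> \<partial>M)"
    by (intro nn_integral_cong) (auto split: split_indicator)
  also have "\<dots> = emeasure M {\<omega> \<in> space M. y \<le> X \<omega>}"
    by simp
  finally show ?thesis by (simp add: emeasure_eq_measure)
qed

section \<open>Discretisation of the workload\<close>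

lemma riemann_sum_error:
  fixes f :: "real \<Rightarrow> real"
  assumes cont: "continuous_on {0..T} f" and s: "0 \<le> s" "real m * s \<le> T"
    and osc: "\<And>x y. x \<in> {0..T} \<Longrightarrow> y \<in> {0..T} \<Longrightarrow> \<bar>x - y\<bar> \<le> s \<Longrightarrow> \<bar>f x - f y\<bar> \<le> e"
    and k: "k \<le> m"
  shows "\<bar>integral {0..real k * s} f - s * (\<Sum>i<k. f (real i * s))\<bar> \<le> e * (real k * s)"
  using k
proof (induction k)
  case (Suc k)
  define x y where "x = real k * s" and "y = real (Suc k) * s"
  have "y \<le> real m * s" using Suc.prems s unfolding y_def by (intro mult_right_mono) auto
  then have xy: "0 \<le> x" "x \<le> y" "y \<le> T" "y - x = s"
    using s by (auto simp: x_def y_def algebra_simps)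
  have "continuous_on {0..y} f" "continuous_on {x..y} f"
    using xy by (auto intro: continuous_on_subset[OF cont])
  then have int: "f integrable_on {0..y}" "f integrable_on {x..y}" "continuous_on {x..y} f"
    by (auto intro: integrable_continuous_real)
  have "integral {0..y} f = integral {0..x} f + integral {x..y} f"
    using Henstock_Kurzweil_Integration.integral_combine[OF xy(1,2) int(1)] by simp
  moreover have "\<bar>integral {x..y} f - s * f x\<bar> \<le> e * s"
  proof -
    have "integral {x..y} (\<lambda>t. f t - f x) = integral {x..y} f - s * f x"
      using xy by (subst Henstock_Kurzweil_Integration.integral_diff) (auto intro: int)
    moreover have "norm (integral {x..y} (\<lambda>t. f t - f x)) \<le> e * (y - x)"
      using xy by (intro integral_bound continuous_intros int) (auto intro!: osc)
    ultimately show ?thesis using xy by simp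
  qed
  moreover have "\<bar>integral {0..x} f - s * (\<Sum>i<k. f (real i * s))\<bar> \<le> e * x"
    using Suc by (simp add: x_def)
  moreover have "s * (\<Sum>i<Suc k. f (real i * s)) = s * (\<Sum>i<k. f (real i * s)) + s * f x"
    by (simp add: x_def distrib_left)
  moreover have "e * y = e * x + e * s"
    using xy(4) by (simp add: distrib_left[symmetric])
  ultimately have "\<bar>integral {0..y} f - s * (\<Sum>i<Suc k. f (real i * s))\<bar> \<le> e * y"
    by linarith
  then show ?case by (simp add: y_def)
qed simp

lemma riemann_sum_tendsto:
  fixes f :: "real \<Rightarrow> real"
  assumes T: "T > 0" and cont: "continuous_on {0..T} f"
  shows "(\<lambda>m. T / real m * (\<Sum>k<m. f (real k * (T / real m)))) \<longlonglongrightarrow> (LBINT x:{0..T}. f x)"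
proof (rule LIMSEQ_I)
  fix r :: real assume r: "r > 0"
  have eq: "(LBINT x:{0..T}. f x) = integral {0..T} f"
    using borel_integrable_atLeastAtMost'[OF cont] by (rule set_borel_integral_eq_integral)
  have "uniformly_continuous_on {0..T} f"
    using cont by (intro compact_uniformly_continuous) auto
  then obtain d where d: "d > 0"
      "\<And>x y. x \<in> {0..T} \<Longrightarrow> y \<in> {0..T} \<Longrightarrow> \<bar>x - y\<bar> < d \<Longrightarrow> \<bar>f x - f y\<bar> < r / (2 * T)"
    using r T unfolding uniformly_continuous_on_def dist_real_def
    by (metis divide_pos_pos mult_pos_pos zero_less_numeral)
  obtain m0 :: nat where m0: "T / d < real m0" using reals_Archimedean2 by blast
  show "\<exists>no. \<forall>m\<ge>no. norm (T / real m * (\<Sum>k<m. f (real k * (T / real m))) - (LBINT x:{0..T}. f x)) < r"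
  proof (intro exI[of _ m0] allI impI)
    fix m assume "m \<ge> m0"
    then have "T / d < real m" using m0 by simp
    moreover have "0 < T / d" using T d by simp
    ultimately have m: "T / d < real m" "real m > 0" by linarith+
    then have s: "T / real m < d" using T d by (simp add: field_simps)
    have mT: "real m * (T / real m) = T" using m by simp
    have "\<bar>integral {0..real m * (T / real m)} f - T / real m * (\<Sum>i<m. f (real i * (T / real m)))\<bar>
        \<le> r / (2 * T) * (real m * (T / real m))"
    proof (rule riemann_sum_error[OF cont])
      show "0 \<le> T / real m" "real m * (T / real m) \<le> T" using T m mT by auto
      show "\<bar>f x - f y\<bar> \<le> r / (2 * T)"
        if "x \<in> {0..T}" "y \<in> {0..T}" "\<bar>x - y\<bar> \<le> T / real m" for x y
        using d(2)[of x y] that s by simp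
    qed simp
    also have "r / (2 * T) * (real m * (T / real m)) = r / 2" using T unfolding mT by simp
    also have "\<dots> < r" using r by simp
    finally show "norm (T / real m * (\<Sum>k<m. f (real k * (T / real m))) - (LBINT x:{0..T}. f x)) < r"
      unfolding eq mT by (simp add: abs_minus_commute)
  qed
qed

text \<open>All unbounded sets share the same \<open>Sup\<close>, so on the exceptional event the
  workload is one constant for all times and samples, which keeps its area measurable.\<close>

lemma Sup_real_unbounded:
  fixes S :: "real set"
  assumes "\<not> bdd_above S"
  shows "Sup S = (LEAST z. False)"
  proof -
  have "(\<lambda>z. \<forall>x\<in>S. x \<le> z) = (\<lambda>z. False)"
    using assms by (auto simp: bdd_above_def fun_eq_iff)
  then show ?thesis by (simp add: Sup_real_def)
qed

text \<open>The grid of mesh \<open>h / m\<close> starts at \<open>- m h\<close>, so that it exhausts the past as \<open>m\<close> grows;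
  index \<open>m * m\<close> is time \<open>0\<close>.\<close>

definition grid :: "real \<Rightarrow> nat \<Rightarrow> nat \<Rightarrow> real" where
  "grid h m i = (real i - real (m * m)) * (h / real m)"

definition drift_increment :: "real \<Rightarrow> (real \<Rightarrow> 'a \<Rightarrow> real) \<Rightarrow> real \<Rightarrow> nat \<Rightarrow> nat \<Rightarrow> 'a \<Rightarrow> real" where
  "drift_increment c B h m i \<omega> = B (grid h m (Suc i)) \<omega> - B (grid h m i) \<omega> - c * (h / real m)"

text \<open>Only time 0 is mentioned: by path continuity, finiteness of the supremum at one time is
  equivalent to finiteness at every time.\<close>

definition finite_past :: "real \<Rightarrow> (real \<Rightarrow> 'a \<Rightarrow> real) \<Rightarrow> 'a \<Rightarrow> bool" where
  "finite_past c B \<omega> \<longleftrightarrow> bdd_above ((\<lambda>s. c * s - B s \<omega>) ` {..0})"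

lemma grid_Suc: "grid h m (Suc i) = grid h m i + h / real m"
  by (simp add: grid_def algebra_simps add_divide_distrib)

lemma grid_shift: "grid h m (m * m + k) = real k * (h / real m)"
  by (simp add: grid_def)

lemma grid_mono: "h \<ge> 0 \<Longrightarrow> i \<le> j \<Longrightarrow> grid h m i \<le> grid h m j"
  unfolding grid_def by (intro mult_right_mono) auto

lemma grid_floor:
  assumes h: "h > 0" and m: "m > 0" and s: "- (real m * h) \<le> s"
  obtains j where "grid h m j \<le> s" "s < grid h m j + h / real m"
proof -
  define j where "j = nat \<lfloor>(s + real m * h) / (h / real m)\<rfloor>"
  have pos: "(s + real m * h) / (h / real m) \<ge> 0" using assms by simp
  then have j: "real j \<le> (s + real m * h) / (h / real m)" "(s + real m * h) / (h / real m) < real j + 1"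
    unfolding j_def by linarith+
  have hm: "h / real m > 0" using assms by simp
  have "real j * (h / real m) \<le> s + real m * h" "s + real m * h < (real j + 1) * (h / real m)"
    using j hm by (simp_all only: pos_le_divide_eq pos_divide_less_eq)
  moreover have "real (m * m) * (h / real m) = real m * h" using m by simp
  then have "grid h m j = real j * (h / real m) - real m * h"
    unfolding grid_def by (simp only: left_diff_distrib)
  moreover have "(real j + 1) * (h / real m) = real j * (h / real m) + h / real m"
    by (simp only: distrib_right mult_1)
  ultimately show thesis
    by (intro that[of j]) linarith+
qed

lemma workload_infinite:
  assumes "\<not> bdd_above ((\<lambda>s. B t \<omega> - B s \<omega> - c * (t - s)) ` {..t})"
  shows "workload c B t \<omega> = (LEAST z. False)"
  unfolding workload_def by (rule Sup_real_unbounded) (use assms in auto)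

section \<open>The workload as a reflected path, and its grid approximation\<close>

context
  fixes B :: "real \<Rightarrow> 'a \<Rightarrow> real" and \<omega> :: 'a and c :: real
  assumes cont: "continuous_on UNIV (\<lambda>t. B t \<omega>)"
begin

text \<open>The negative of the drifted path. The workload is the running supremum of
  \<open>g\<close> minus \<open>g\<close>, that is, \<open>- g\<close> reflected at 0.\<close>

private definition g :: "real \<Rightarrow> real" where "g s = c * s - B s \<omega>"

private lemma cont_g: "continuous_on A g"
  unfolding g_def by (intro continuous_intros continuous_on_subset[OF cont]) auto

private lemma bdd_g_iff: "bdd_above (g ` {..t}) \<longleftrightarrow> finite_past c B \<omega>"
proof -
  have *: "bdd_above (g ` {..a}) \<Longrightarrow> bdd_above (g ` {..b})" for a b
  proof -
    assume bdd: "bdd_above (g ` {..a})"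
    have "bdd_above (g ` {a..b})"
      by (intro bounded_imp_bdd_above compact_imp_bounded compact_continuous_image cont_g) auto
    with bdd have "bdd_above (g ` {..a} \<union> g ` {a..b})" by simp
    then show "bdd_above (g ` {..b})"
    proof (rule bdd_above_mono)
      have "{..b} \<subseteq> {..a} \<union> {a..b}" by auto
      then show "g ` {..b} \<subseteq> g ` {..a} \<union> g ` {a..b}" by blast
    qed
  qed
  have "finite_past c B \<omega> \<longleftrightarrow> bdd_above (g ` {..0})"
    by (simp add: finite_past_def g_def[abs_def])
  then show ?thesis using *[of t 0] *[of 0 t] by metis
qed

private lemma bdd_workload_iff:
  "bdd_above ((\<lambda>s. B t \<omega> - B s \<omega> - c * (t - s)) ` {..t}) \<longleftrightarrow> finite_past c B \<omega>"
proof -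
  have "(\<lambda>s. B t \<omega> - B s \<omega> - c * (t - s)) = (\<lambda>s. (B t \<omega> - c * t) + g s)"
    by (auto simp: g_def algebra_simps)
  moreover have "bdd_above ((\<lambda>s. a + g s) ` {..t}) \<longleftrightarrow> bdd_above (g ` {..t})" for a
  proof
    assume "bdd_above ((\<lambda>s. a + g s) ` {..t})"
    then obtain K where "\<And>s. s \<le> t \<Longrightarrow> a + g s \<le> K" by (auto simp: bdd_above_def)
    then have "\<And>s. s \<le> t \<Longrightarrow> g s \<le> K - a" by (simp add: algebra_simps)
    then show "bdd_above (g ` {..t})" by (intro bdd_aboveI[of _ "K - a"]) auto
  next
    assume "bdd_above (g ` {..t})"
    then obtain K where "\<And>s. s \<le> t \<Longrightarrow> g s \<le> K" by (auto simp: bdd_above_def)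
    then show "bdd_above ((\<lambda>s. a + g s) ` {..t})" by (intro bdd_aboveI[of _ "a + K"]) auto
  qed
  ultimately show ?thesis by (simp only: bdd_g_iff)
qed

lemma workload_not_finite_past:
  "\<not> finite_past c B \<omega> \<Longrightarrow> workload c B t \<omega> = (LEAST z. False)"
  using bdd_workload_iff workload_infinite by metis

private lemma drift_increment_g:
  "drift_increment c B h m i \<omega> = - g (grid h m (Suc i)) - (- g (grid h m i))"
  by (simp add: drift_increment_def g_def grid_Suc algebra_simps)

text \<open>Some past point \<open>s0\<close> has a large \<open>g\<close>; once the grid reaches
  back to \<open>s0\<close> and is fine enough, a grid point near \<open>s0\<close> does almost as
  well. This gives the measurability of \<open>finite_past\<close> and shows that it fails with
  probability 0.\<close>

lemma lindley_unbounded: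
  assumes nf: "\<not> finite_past c B \<omega>" and h: "h > 0"
  shows "eventually (\<lambda>m. x \<le> lindley (\<lambda>i. drift_increment c B h m i \<omega>) 0 (m * m)) sequentially"
proof -
  have "\<not> bdd_above (g ` {..0})" using nf bdd_g_iff by blast
  \<comment> \<open>The extra 1 pays for replacing \<open>s0\<close> by a nearby grid point.\<close>
  then obtain s0 where s0: "s0 \<le> 0" "g s0 > x + 1 + g 0"
    unfolding bdd_above_def by (metis imageE atMost_iff linorder_not_le)
  have "continuous (at s0) g"
    using cont_g[of UNIV] by (simp add: continuous_on_eq_continuous_at)
  then obtain d where d: "d > 0" "\<And>y. \<bar>y - s0\<bar> < d \<Longrightarrow> \<bar>g y - g s0\<bar> < 1"
    unfolding continuous_at_eps_delta dist_real_def by (metis zero_less_one)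
  obtain m0 :: nat where m0: "max (h / d) (- s0 / h) < real m0" using reals_Archimedean2 by blast
  show ?thesis
    unfolding eventually_sequentially
  proof (intro exI[of _ m0] allI impI)
    fix m assume "m \<ge> m0"
    then have m: "h / d < real m" "- s0 / h < real m" using m0 by simp_all
    have m1: "real m > 0" using m(1) h d by (smt (verit) divide_pos_pos)
    have hm: "h / real m < d" using m m1 d by (simp add: field_simps)
    have "- (real m * h) \<le> s0" using m(2) h by (simp add: field_simps)
    then obtain j where j: "grid h m j \<le> s0" "s0 < grid h m j + h / real m"
      using grid_floor h m1 by (metis of_nat_0_less_iff)
    have "j \<le> m * m"
    proof (rule ccontr)
      assume "\<not> j \<le> m * m"
      then have "grid h m j > 0" unfolding grid_def using h m1
        by (intro mult_pos_pos) (auto simp del: of_nat_mult)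
      then show False using j s0 by simp
    qed
    then have "- g (grid h m (m * m)) - (- g (grid h m j)) \<le>
        lindley (\<lambda>i. - g (grid h m (Suc i)) - (- g (grid h m i))) 0 (m * m)"
      by (rule lindley_increments_ge[where w = "\<lambda>i. - g (grid h m i)"])
    moreover have "\<bar>g (grid h m j) - g s0\<bar> < 1" using j hm by (intro d) auto
    moreover have "grid h m (m * m) = 0" by (simp add: grid_def)
    ultimately show "x \<le> lindley (\<lambda>i. drift_increment c B h m i \<omega>) 0 (m * m)"
      using s0 unfolding drift_increment_g by simp
  qed
qed

context
  assumes fin: "finite_past c B \<omega>"
begin

lemma lindley_bounded:
  assumes h: "h > 0"
  shows "\<exists>K. \<forall>m. lindley (\<lambda>i. drift_increment c B h m i \<omega>) 0 (m * m) \<le> K"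
proof -
  have "bdd_above (g ` {..0})" using fin bdd_g_iff by simp
  then obtain K where K: "\<And>s. s \<le> 0 \<Longrightarrow> g s \<le> K" by (auto simp: bdd_above_def)
  have "lindley (\<lambda>i. drift_increment c B h m i \<omega>) 0 (m * m) \<le> K - g 0" for m
  proof -
    obtain j where j: "j \<le> m * m" "lindley (\<lambda>i. drift_increment c B h m i \<omega>) 0 (m * m) =
        - g (grid h m (m * m)) - (- g (grid h m j))"
      using lindley_increments_attained[of "m * m" "\<lambda>i. - g (grid h m i)"]
      unfolding drift_increment_g by blast
    have "grid h m (m * m) = 0" by (simp add: grid_def)
    moreover from this have "grid h m j \<le> 0" using grid_mono[OF less_imp_le[OF h] j(1), of m] by simp
    ultimately show ?thesis using j(2) K by simp
  qed
  then show ?thesis by blast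
qed

private definition G :: "real \<Rightarrow> real" where "G t = (SUP s\<in>{..t}. g s)"

private lemma G_ge: "s \<le> t \<Longrightarrow> g s \<le> G t"
  unfolding G_def using fin bdd_g_iff by (intro cSUP_upper) auto

private lemma G_le: "(\<And>s. s \<le> t \<Longrightarrow> g s \<le> z) \<Longrightarrow> G t \<le> z"
  unfolding G_def by (intro cSUP_least) auto

private lemma G_approx:
  assumes "e > 0"
  obtains s where "s \<le> t" "G t - e \<le> g s"
proof (rule ccontr)
  assume "\<not> thesis"
  then have "g s \<le> G t - e" if "s \<le> t" for s
    using that \<open>\<not> thesis\<close> \<open>\<And>s. s \<le> t \<Longrightarrow> G t - e \<le> g s \<Longrightarrow> thesis\<close> by (meson linear)
  then have "G t \<le> G t - e" by (rule G_le)
  then show False using assms by simp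
qed

lemma workload_ge:
  assumes "s \<le> t"
  shows "B t \<omega> - B s \<omega> - c * (t - s) \<le> workload c B t \<omega>"
  unfolding workload_def using assms fin bdd_workload_iff
  by (intro cSUP_upper) auto

lemma workload_nonneg: "0 \<le> workload c B t \<omega>"
  using workload_ge[of t t] by simp

private lemma workload_eq: "workload c B t \<omega> = G t - g t"
proof (rule antisym)
  show "workload c B t \<omega> \<le> G t - g t"
    unfolding workload_def
  proof (intro cSUP_least)
    fix s assume "s \<in> {..t}"
    then show "B t \<omega> - B s \<omega> - c * (t - s) \<le> G t - g t"
      using G_ge[of s t] by (auto simp: g_def algebra_simps)
  qed auto
  have "G t \<le> workload c B t \<omega> + g t"
  proof (rule G_le)
    fix s assume "s \<le> t"
    then show "g s \<le> workload c B t \<omega> + g t"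
      using workload_ge[of s t] by (simp add: g_def algebra_simps)
  qed
  then show "G t - g t \<le> workload c B t \<omega>" by simp
qed

text \<open>The running supremum \<open>G\<close> inherits the modulus of continuity of
  \<open>g\<close>: between \<open>x\<close> and \<open>y\<close> it rises by at most the excess of
  \<open>g\<close> over \<open>g x\<close> there.\<close>

lemma continuous_on_workload: "continuous_on {a..b} (\<lambda>t. workload c B t \<omega>)"
proof -
  have G_osc: "\<bar>G x - G y\<bar> \<le> e"
    if osc: "\<And>u v. u \<in> {a..b} \<Longrightarrow> v \<in> {a..b} \<Longrightarrow> \<bar>u - v\<bar> < d \<Longrightarrow> \<bar>g u - g v\<bar> \<le> e"
    and xy: "x \<in> {a..b}" "y \<in> {a..b}" "\<bar>x - y\<bar> < d" for x y d e
  proof -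
    have *: "G x \<le> G y \<and> G y \<le> G x + e" if "x \<le> y" "x \<in> {a..b}" "y \<in> {a..b}" "y - x < d" for x y
    proof
      show "G x \<le> G y" using that by (intro G_le G_ge) auto
      have "e \<ge> 0" using osc[of x x] that by fastforce
      show "G y \<le> G x + e"
      proof (rule G_le)
        fix s assume s: "s \<le> y"
        show "g s \<le> G x + e"
        proof (cases "s \<le> x")
          case True
          then show ?thesis using G_ge[of s x] \<open>e \<ge> 0\<close> by simp
        next
          case False
          then have "\<bar>g s - g x\<bar> \<le> e" using that s by (intro osc) auto
          then show ?thesis using G_ge[of x x] by simp
        qed
      qed
    qed
    show ?thesis
      using *[of x y] *[of y x] xy by (cases "x \<le> y") (auto simp: abs_le_iff)
  qed
  have "continuous_on {a..b} G"
  proof -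
    have "uniformly_continuous_on {a..b} g"
      by (intro compact_uniformly_continuous cont_g) auto
    then have "uniformly_continuous_on {a..b} G"
      unfolding uniformly_continuous_on_def dist_real_def
    proof (intro allI impI)
      fix e :: real
      assume uc: "\<forall>e>0. \<exists>d>0. \<forall>x\<in>{a..b}. \<forall>x'\<in>{a..b}. \<bar>x' - x\<bar> < d \<longrightarrow> \<bar>g x' - g x\<bar> < e" and e: "e > 0"
      obtain d where d: "d > 0" "\<forall>x\<in>{a..b}. \<forall>x'\<in>{a..b}. \<bar>x' - x\<bar> < d \<longrightarrow> \<bar>g x' - g x\<bar> < e / 2"
        using uc e half_gt_zero by blast
      have "\<bar>G x' - G x\<bar> < e" if "x \<in> {a..b}" "x' \<in> {a..b}" "\<bar>x' - x\<bar> < d" for x x'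
      proof -
        have "\<bar>G x' - G x\<bar> \<le> e / 2"
          using d that by (intro G_osc[where d = d]) (auto intro!: less_imp_le)
        then show ?thesis using e by simp
      qed
      then show "\<exists>d>0. \<forall>x\<in>{a..b}. \<forall>x'\<in>{a..b}. \<bar>x' - x\<bar> < d \<longrightarrow> \<bar>G x' - G x\<bar> < e"
        using d(1) by blast
    qed
    then show ?thesis by (rule uniformly_continuous_imp_continuous)
  qed
  then show ?thesis
    unfolding workload_eq by (intro continuous_intros cont_g)
qed

text \<open>The maximum over grid points never exceeds the supremum. Conversely, a near-maximiser of
  \<open>g\<close> is rounded down to the grid, with an error controlled by uniform continuity on
  one compact interval for all times up to \<open>T\<close>.\<close>

private lemma lindley_approx:
  assumes h: "h > 0" and e: "e > 0"
  shows "eventually (\<lambda>m. m > 0 \<and> (\<forall>k. real k * (h / real m) \<le> T \<longrightarrow>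
    \<bar>lindley (\<lambda>i. drift_increment c B h m i \<omega>) 0 (m * m + k) - workload c B (real k * (h / real m)) \<omega>\<bar> \<le> e)) sequentially"
proof -
  \<comment> \<open>\<open>s0\<close> stands in for every point before it, so that near-maximisers
    for all times in \<open>[0, T]\<close> can be found in \<open>[s0, T]\<close>.\<close>
  obtain s0 where s0: "s0 \<le> 0" "G 0 - e / 3 \<le> g s0" using G_approx[of "e / 3" 0] e by auto
  \<comment> \<open>The margin 1 leaves room for rounding down to the grid, whose mesh will be below
    1.\<close>
  have "uniformly_continuous_on {s0 - 1..T} g"
    by (intro compact_uniformly_continuous cont_g) auto
  then obtain d where d: "d > 0" "\<And>x y. x \<in> {s0-1..T} \<Longrightarrow> y \<in> {s0-1..T} \<Longrightarrow> \<bar>y - x\<bar> < d \<Longrightarrow> \<bar>g y - g x\<bar> < e / 3"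
    unfolding uniformly_continuous_on_def dist_real_def using e
    by (metis divide_pos_pos zero_less_numeral)
  obtain m0 :: nat where m0: "max (h / min d 1) (- s0 / h) < real m0" using reals_Archimedean2 by blast
  show ?thesis
    unfolding eventually_sequentially
  proof (intro exI[of _ m0] allI impI conjI)
    fix m assume "m \<ge> m0"
    then have m: "h / min d 1 < real m" "- s0 / h < real m" using m0 by simp_all
    have m1: "real m > 0" using m(1) h d by (smt (verit) divide_pos_pos)
    then show "m > 0" by simp
    have "min d 1 > 0" using d by simp
    then have "h / real m < min d 1" using m(1) m1 by (simp only: pos_divide_less_eq mult.commute)
    then have hm: "h / real m < d" "h / real m < 1" by simp_all
    have hm0: "h / real m > 0" using h m1 by simp
    fix k assume k: "real k * (h / real m) \<le> T"
    let ?t = "real k * (h / real m)"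
    have t: "grid h m (m * m + k) = ?t" by (rule grid_shift)
    have t0: "?t \<ge> 0" using h by simp
    let ?L = "lindley (\<lambda>i. drift_increment c B h m i \<omega>) 0 (m * m + k)"
    obtain j where j: "j \<le> m * m + k" "?L = - g (grid h m (m * m + k)) - (- g (grid h m j))"
      using lindley_increments_attained[of "m * m + k" "\<lambda>i. - g (grid h m i)"]
      unfolding drift_increment_g by blast
    have "grid h m j \<le> ?t" using grid_mono[of h j "m * m + k" m] j h t by simp
    then have up: "?L \<le> workload c B ?t \<omega>"
      using G_ge j(2) unfolding workload_eq t by simp
    \<comment> \<open>If the near-maximiser lies before \<open>s0\<close>, switching to
      \<open>s0\<close> costs a second \<open>e / 3\<close>; rounding to the grid costs the
      third.\<close>
    obtain s where s: "s0 \<le> s" "s \<le> ?t" "G ?t - 2 * e / 3 \<le> g s"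
    proof -
      obtain s where s: "s \<le> ?t" "G ?t - e / 3 \<le> g s" using G_approx[of "e / 3" ?t] e by auto
      show thesis
      proof (cases "s0 \<le> s")
        case True
        then show thesis using s e by (intro that[of s]) auto
      next
        case False
        then have "g s \<le> G 0" using s0 by (intro G_ge) auto
        then show thesis using s s0 t0 by (intro that[of s0]) auto
      qed
    qed
    have "- (real m * h) \<le> s" using m(2) h s by (simp add: field_simps)
    then obtain i where i: "grid h m i \<le> s" "s < grid h m i + h / real m"
      using grid_floor h m1 by (metis of_nat_0_less_iff)
    have "i \<le> m * m + k"
    proof (rule ccontr)
      assume "\<not> i \<le> m * m + k"
      then have "grid h m (Suc (m * m + k)) \<le> grid h m i" using h by (intro grid_mono) auto
      then show False using i s hm0 unfolding grid_Suc t by linarith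
    qed
    then have "- g (grid h m (m * m + k)) - (- g (grid h m i)) \<le> ?L"
      using lindley_increments_ge[of i "m * m + k" "\<lambda>i. - g (grid h m i)"]
      unfolding drift_increment_g by blast
    moreover have "\<bar>g (grid h m i) - g s\<bar> < e / 3"
      using i s hm k by (intro d) auto
    ultimately have "workload c B ?t \<omega> - e \<le> ?L"
      using s unfolding workload_eq t by linarith
    then show "\<bar>?L - workload c B ?t \<omega>\<bar> \<le> e" using up e by linarith
  qed
qed

lemma lindley_area_tendsto:
  assumes h: "h > 0" and N: "N > 0"
  shows "(\<lambda>m. h / real m * (\<Sum>k<m * N. lindley (\<lambda>i. drift_increment c B h m i \<omega>) 0 (m * m + k)))
    \<longlonglongrightarrow> (LBINT r:{0..real N * h}. workload c B r \<omega>)"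
proof -
  let ?T = "real N * h"
  let ?R = "\<lambda>m. h / real m * (\<Sum>k<m * N. workload c B (real k * (h / real m)) \<omega>)"
  let ?A = "\<lambda>m. h / real m * (\<Sum>k<m * N. lindley (\<lambda>i. drift_increment c B h m i \<omega>) 0 (m * m + k))"
  have "(\<lambda>m. ?T / real m * (\<Sum>k<m. workload c B (real k * (?T / real m)) \<omega>)) \<longlonglongrightarrow>
      (LBINT r:{0..?T}. workload c B r \<omega>)"
    using h N by (intro riemann_sum_tendsto continuous_on_workload) auto
  \<comment> \<open>With \<open>m * N\<close> points on \<open>[0, N h]\<close> the mesh is
    \<open>h / m\<close>, so the Riemann sums are taken along this subsequence.\<close>
  then have "((\<lambda>m. ?T / real m * (\<Sum>k<m. workload c B (real k * (?T / real m)) \<omega>)) \<circ> (\<lambda>m. m * N)) \<longlonglongrightarrow>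
      (LBINT r:{0..?T}. workload c B r \<omega>)"
    by (rule LIMSEQ_subseq_LIMSEQ) (use N in \<open>auto simp: strict_mono_def\<close>)
  then have R: "?R \<longlonglongrightarrow> (LBINT r:{0..?T}. workload c B r \<omega>)"
    using N by (simp add: o_def)
  have "(\<lambda>m. ?A m - ?R m) \<longlonglongrightarrow> 0"
  proof (rule tendstoI)
    fix e :: real assume e: "e > 0"
    have "e / (2 * ?T) > 0" using e h N by simp
    from lindley_approx[OF h this, of ?T]
    show "eventually (\<lambda>m. dist (?A m - ?R m) 0 < e) sequentially"
    proof (rule eventually_mono, elim conjE)
      fix m assume m: "m > 0" and *: "\<forall>k. real k * (h / real m) \<le> ?T \<longrightarrow>
        \<bar>lindley (\<lambda>i. drift_increment c B h m i \<omega>) 0 (m * m + k) - workload c B (real k * (h / real m)) \<omega>\<bar> \<le> e / (2 * ?T)"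
      have "\<bar>?A m - ?R m\<bar> = h / real m * \<bar>\<Sum>k<m * N. lindley (\<lambda>i. drift_increment c B h m i \<omega>) 0 (m * m + k) -
          workload c B (real k * (h / real m)) \<omega>\<bar>"
        using h unfolding right_diff_distrib[symmetric] sum_subtractf[symmetric] abs_mult by simp
      also have "\<dots> \<le> h / real m * (\<Sum>k<m * N. e / (2 * ?T))"
      proof (intro mult_left_mono order_trans[OF sum_abs] sum_mono)
        fix k assume "k \<in> {..<m * N}"
        then have "real k \<le> real (m * N)" by (simp del: of_nat_mult)
        then have "real k * (h / real m) \<le> real (m * N) * (h / real m)"
          using h by (intro mult_right_mono) auto
        also have "\<dots> = ?T" using m by simp
        finally show "\<bar>lindley (\<lambda>i. drift_increment c B h m i \<omega>) 0 (m * m + k) - workload c B (real k * (h / real m)) \<omega>\<bar> \<le> e / (2 * ?T)"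
          using * by blast
      qed (use h in auto)
      also have "\<dots> = e / 2" using m N h by simp
      finally show "dist (?A m - ?R m) 0 < e" using e by simp
    qed
  qed
  from tendsto_add[OF this R] show ?thesis by simp
qed

end

end

section \<open>Block decomposition\<close>

text \<open>Fatou's lemma for events: samples lying in infinitely many \<open>A n\<close> lie in
  \<open>B\<close>. The sets \<open>?C n\<close>, outside \<open>B\<close> and outside all later
  \<open>A i\<close>, increase to the complement of \<open>B\<close>.\<close>

lemma (in prob_space) prob_ge_of_infinitely_often:
  assumes A: "\<And>n. A n \<in> events" and B: "B \<in> events"
    and ev: "\<And>\<omega>. \<omega> \<in> space M \<Longrightarrow> \<omega> \<notin> B \<Longrightarrow> eventually (\<lambda>n. \<omega> \<notin> A n) sequentially"
    and b: "eventually (\<lambda>n. b \<le> prob (A n)) sequentially"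
  shows "b \<le> prob B"
proof -
  let ?C = "\<lambda>n. \<Inter>i\<in>{n..}. (space M - B) \<inter> (space M - A i)"
  have C: "?C n \<in> events" for n using A B by (intro sets.countable_INT) auto
  have "incseq ?C" by (auto simp: incseq_def)
  then have "(\<lambda>n. prob (?C n)) \<longlonglongrightarrow> prob (\<Union>n. ?C n)"
    using C by (intro finite_Lim_measure_incseq) auto
  also have "(\<Union>n. ?C n) = space M - B"
  proof
    show "space M - B \<subseteq> (\<Union>n. ?C n)"
    proof
      fix \<omega> assume \<omega>: "\<omega> \<in> space M - B"
      then obtain n where "\<And>i. i \<ge> n \<Longrightarrow> \<omega> \<notin> A i"
        using ev[of \<omega>] unfolding eventually_sequentially by blast
      with \<omega> have "\<omega> \<in> ?C n" by auto
      then show "\<omega> \<in> (\<Union>n. ?C n)" by blast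
    qed
  qed auto
  finally have "(\<lambda>n. prob (?C n)) \<longlonglongrightarrow> 1 - prob B"
    using B by (simp add: prob_compl)
  moreover have "eventually (\<lambda>n. prob (?C n) \<le> 1 - b) sequentially"
    using b
  proof eventually_elim
    case (elim n)
    have "prob (?C n) \<le> prob (space M - A n)"
      using A by (intro finite_measure_mono) auto
    then show ?case using elim A by (simp add: prob_compl)
  qed
  ultimately have "1 - prob B \<le> 1 - b"
    by (intro tendsto_upperbound) auto
  then show ?thesis by simp
qed

lemma (in prob_space) prob_le_of_eventually:
  assumes A: "\<And>n. A n \<in> events" and B: "B \<in> events"
    and ev: "\<And>\<omega>. \<omega> \<in> B \<Longrightarrow> eventually (\<lambda>n. \<omega> \<in> A n) sequentially"
    and b: "eventually (\<lambda>n. prob (A n) \<le> b) sequentially"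
  shows "prob B \<le> b"
proof -
  have "1 - b \<le> prob (space M - B)"
  proof (rule prob_ge_of_infinitely_often)
    show "eventually (\<lambda>n. 1 - b \<le> prob (space M - A n)) sequentially"
      using b by eventually_elim (use A in \<open>simp add: prob_compl\<close>)
    show "eventually (\<lambda>n. \<omega> \<notin> space M - A n) sequentially"
      if "\<omega> \<in> space M" "\<omega> \<notin> space M - B" for \<omega>
      using ev[of \<omega>] that by (auto elim: eventually_mono)
  qed (use A B in auto)
  then show ?thesis using B by (simp add: prob_compl)
qed

definition block_start :: "nat \<Rightarrow> nat \<Rightarrow> nat" where
  "block_start m j = m * m + j * m"

text \<open>Block \<open>0\<close> is the whole past; block \<open>j + 1\<close> is the time interval \<open>[j h, (j + 1) h]\<close>, whose grid
  increments start at index \<open>block_start m j\<close>.\<close>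

fun energy :: "real \<Rightarrow> real \<Rightarrow> nat \<Rightarrow> nat \<Rightarrow> (nat \<Rightarrow> real) \<Rightarrow> real" where
  "energy c h m 0 x = 2 * c * lindley x 0 (m * m)"
| "energy c h m (Suc j) x = max (2 * c * lindley x (block_start m j) m)
     (((\<Sum>i<m. x (block_start m j + i)) + c * h)\<^sup>2 / (2 * h))"

text \<open>Multiplied by \<open>h\<close>, this is the Riemann sum over
  \<open>[j h, (j + 1) h]\<close> for the area of the workload restarted empty at
  \<open>j h\<close>.\<close>

definition mean_block_lindley :: "nat \<Rightarrow> nat \<Rightarrow> (nat \<Rightarrow> real) \<Rightarrow> real" where
  "mean_block_lindley m j x = (\<Sum>k<m. lindley x (block_start m j) k) / real m"

lemma block_start_Suc: "block_start m (Suc j) = block_start m j + m"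
  by (simp add: block_start_def)

lemma block_start_ge: "m * m \<le> block_start m j"
  by (simp add: block_start_def)

lemma block_start_mono: "i < j \<Longrightarrow> block_start m i + m \<le> block_start m j"
  using mult_le_mono1[of "Suc i" j m] by (simp add: block_start_def)

lemma grid_block_start: "m > 0 \<Longrightarrow> grid h m (block_start m j) = real j * h"
  by (simp add: grid_def block_start_def)

text \<open>Within a block, \<open>lindley_add_le\<close> separates the level at the block start
  from the restarted workload. The levels at block starts obey the recursion of
  \<open>area_le_energy\<close>, where \<open>Q j = r j\<close> means that the level comes from the
  latest block alone.\<close>

lemma lindley_area_le:
  fixes x :: "nat \<Rightarrow> real" and N :: nat
  assumes c: "c > 0" and h: "h > 0" and m: "m > 0"
  defines "E \<equiv> (\<Sum>j<N. energy c h m j x)"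
  shows "h / real m * (\<Sum>k<m * N. lindley x 0 (m * m + k)) \<le>
    3 / (8 * c ^ 3) * (E\<^sup>2 + 10 * c\<^sup>2 * h * E) + h * (\<Sum>j<N. mean_block_lindley m j x)"
proof -
  define Q where "Q j = lindley x 0 (block_start m j)" for j
  \<comment> \<open>Adding \<open>c * h\<close> undoes the drift: for drifted Brownian increments,
    \<open>X j\<close> is the Brownian increment over the block.\<close>
  define X where "X j = (\<Sum>i<m. x (block_start m j + i)) + c * h" for j
  define r where "r j = (case j of 0 \<Rightarrow> lindley x 0 (m * m) | Suc j \<Rightarrow> lindley x (block_start m j) m)" for j
  have "h / real m * (\<Sum>k<m * N. lindley x 0 (m * m + k)) =
      h / real m * (\<Sum>j<N. \<Sum>k<m. lindley x 0 (block_start m j + k))"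
  proof (induction N)
    case (Suc N)
    have "m * Suc N = m * N + m" by simp
    then have "(\<Sum>k<m * Suc N. lindley x 0 (m * m + k)) =
        (\<Sum>k<m * N. lindley x 0 (m * m + k)) + (\<Sum>k<m. lindley x 0 (m * m + (m * N + k)))"
      by (simp only: sum_lessThan_add)
    then show ?case using Suc
      by (simp add: distrib_left block_start_def add.assoc mult.commute)
  qed simp
  also have "\<dots> \<le> h / real m * (\<Sum>j<N. \<Sum>k<m. Q j + lindley x (block_start m j) k)"
    using h lindley_add_le[of x 0] unfolding Q_def
    by (intro mult_left_mono sum_mono) auto
  also have "\<dots> = h * (\<Sum>j<N. Q j) + h * (\<Sum>j<N. mean_block_lindley m j x)"
    using m by (simp add: sum.distrib mean_block_lindley_def sum_divide_distrib[symmetric]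
        sum_distrib_left[symmetric] field_simps)
  also have "h * (\<Sum>j<N. Q j) \<le> 3 / (8 * c ^ 3) * (E\<^sup>2 + 10 * c\<^sup>2 * h * E)"
    unfolding E_def
  proof (rule area_le_energy[OF c h])
    show "Q 0 = r 0" by (simp add: Q_def r_def block_start_def)
    show "Q (Suc j) = max (Q j + X j - c * h) (r (Suc j))" for j
      using lindley_add[of x 0 "block_start m j" m] by (simp add: Q_def X_def r_def block_start_Suc)
    show "r j \<ge> 0" for j by (cases j) (auto simp: r_def lindley_nonneg)
    show "2 * c * r j \<le> energy c h m j x" for j by (cases j) (auto simp: r_def)
    show "(X j)\<^sup>2 / (2 * h) \<le> energy c h m (Suc j) x" for j by (simp add: X_def)
  qed
  finally show ?thesis by simp
qed

section \<open>Exponential bounds for block energies and restarted workloads\<close>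

context two_sided_brownian_motion
begin

lemma measurable_increment: "s < t \<Longrightarrow> (\<lambda>\<omega>. B t \<omega> - B s \<omega>) \<in> borel_measurable P"
  using distributed_measurable[OF normal_increments] by simp

text \<open>The assumptions give measurability of increments, and \<open>B 0\<close> vanishes on
  \<open>space P\<close>; there each \<open>B t\<close> agrees with an increment or its
  negative.\<close>

lemma measurable_B [measurable]: "B t \<in> borel_measurable P"
proof -
  consider "t = 0" | "t > 0" | "t < 0" by linarith
  then have "\<exists>f \<in> borel_measurable P. \<forall>\<omega>\<in>space P. f \<omega> = B t \<omega>"
  proof cases
    case 1
    then show ?thesis by (intro bexI[of _ "\<lambda>_. 0"]) (auto simp: start_zero)
  next
    case 2
    then show ?thesis
      by (intro bexI[OF _ measurable_increment[of 0 t]]) (auto simp: start_zero)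
  next
    case 3
    then show ?thesis
      by (intro bexI[OF _ borel_measurable_uminus[OF measurable_increment[of t 0]]]) (auto simp: start_zero)
  qed
  then show ?thesis by (metis measurable_cong)
qed

lemma measurable_drift_increment [measurable]: "drift_increment c B h m i \<in> borel_measurable P"
  unfolding drift_increment_def by measurable

lemma strict_mono_grid: "h > 0 \<Longrightarrow> m > 0 \<Longrightarrow> strict_mono_on A (grid h m)"
  unfolding strict_mono_on_def grid_def
  by (intro allI impI mult_strict_right_mono) auto

lemma indep_drift_increments:
  assumes "h > 0" "m > 0"
  shows "indep_vars (\<lambda>_. borel) (drift_increment c B h m) {..<n}"
proof -
  have "indep_vars (\<lambda>_. borel) (\<lambda>i \<omega>. (B (grid h m (Suc i)) \<omega> - B (grid h m i) \<omega>) - c * (h / real m)) {..<n}"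
    using indep_increments[OF strict_mono_grid[OF assms]] by (rule indep_vars_compose2) auto
  then show ?thesis by (simp add: drift_increment_def[abs_def])
qed

text \<open>At exponent \<open>2 * c\<close> the Gaussian variance exactly offsets the drift,
  whatever the mesh; hence the tail bounds below do not depend on \<open>m\<close>.\<close>

lemma nn_integral_exp_drift_increment:
  assumes h: "h > 0" and m: "m > 0"
  shows "(\<integral>\<^sup>+\<omega>. ennreal (exp ((2 * c) * drift_increment c B h m i \<omega>)) \<partial>P) = 1"
proof -
  have hm: "h / real m > 0" using h m by simp
  have *: "grid h m i < grid h m (Suc i)" using hm by (simp add: grid_Suc)
  have d: "grid h m (Suc i) - grid h m i = h / real m" by (simp add: grid_Suc)
  have "(\<integral>\<^sup>+\<omega>. ennreal (exp ((2 * c) * (B (grid h m (Suc i)) \<omega> - B (grid h m i) \<omega>) -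
      (2 * c)\<^sup>2 * (sqrt (h / real m))\<^sup>2 / 2)) \<partial>P) = 1"
    using hm normal_increments[OF *] unfolding d by (intro nn_integral_normal_exp) auto
  also have "(\<lambda>\<omega>. (2 * c) * (B (grid h m (Suc i)) \<omega> - B (grid h m i) \<omega>) -
      (2 * c)\<^sup>2 * (sqrt (h / real m))\<^sup>2 / 2) = (\<lambda>\<omega>. (2 * c) * drift_increment c B h m i \<omega>)"
    using hm h by (simp add: drift_increment_def fun_eq_iff algebra_simps power2_eq_square)
  finally show ?thesis .
qed

lemma prob_lindley_drift_ge:
  assumes c: "c > 0" and h: "h > 0" and m: "m > 0"
  shows "prob {\<omega> \<in> space P. x \<le> lindley (\<lambda>i. drift_increment c B h m i \<omega>) a k} \<le> exp (- (2 * c) * x)"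
  using c nn_integral_exp_drift_increment[OF h m]
  by (intro prob_lindley_ge_le[OF indep_drift_increments[OF h m, of c "a + k"]]) auto

definition tail_const :: "real \<Rightarrow> real" where
  "tail_const \<theta> = exp \<theta> / (1 - exp (\<theta> - 1))"

lemma tail_const_pos: "\<theta> < 1 \<Longrightarrow> tail_const \<theta> > 0"
  by (simp add: tail_const_def)

lemma nn_integral_exp_lindley_drift:
  assumes c: "c > 0" and h: "h > 0" and m: "m > 0" and \<theta>: "0 \<le> \<theta>" "\<theta> < 1"
  shows "(\<integral>\<^sup>+\<omega>. ennreal (exp (\<theta> * (2 * c * lindley (\<lambda>i. drift_increment c B h m i \<omega>) a k))) \<partial>P)
    \<le> ennreal (tail_const \<theta>)"
  unfolding tail_const_def
proof (rule nn_integral_exp_le_of_tail[OF _ _ _ \<theta>])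
  show "(\<lambda>\<omega>. 2 * c * lindley (\<lambda>i. drift_increment c B h m i \<omega>) a k) \<in> borel_measurable P"
    by (intro borel_measurable_times borel_measurable_lindley) auto
  show "0 \<le> 2 * c * lindley (\<lambda>i. drift_increment c B h m i \<omega>) a k" for \<omega>
    using c lindley_nonneg by (intro mult_nonneg_nonneg) auto
  show "prob {\<omega> \<in> space P. real n \<le> 2 * c * lindley (\<lambda>i. drift_increment c B h m i \<omega>) a k} \<le> exp (- real n)" for n
    using prob_lindley_drift_ge[OF c h m, of "real n / (2 * c)" a k] c by (simp add: field_simps)
qed

lemma drift_block_sum:
  assumes m: "m > 0"
  shows "(\<Sum>i<m. drift_increment c B h m (block_start m j + i) \<omega>) + c * h = B (real (Suc j) * h) \<omega> - B (real j * h) \<omega>"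
proof -
  define z where "z = c * (h / real m)"
  have "(\<Sum>i<k. drift_increment c B h m (a + i) \<omega>) =
      B (grid h m (a + k)) \<omega> - B (grid h m a) \<omega> - real k * z" for k a
    by (induction k) (auto simp: drift_increment_def z_def algebra_simps add_divide_distrib)
  from this[of "block_start m j" m] have "(\<Sum>i<m. drift_increment c B h m (block_start m j + i) \<omega>) =
      B (grid h m (block_start m j + m)) \<omega> - B (grid h m (block_start m j)) \<omega> - c * h"
    using m by (simp add: z_def)
  then show ?thesis
    using m grid_block_start[OF m, of h "Suc j"] grid_block_start[OF m, of h j]
    by (simp add: block_start_Suc)
qed

text \<open>The restarted workload and the increment of the same block are dependent, but the
  exponential of a maximum is at most the sum of the exponentials, so each is bounded on its
  own.\<close>

lemma nn_integral_exp_energy: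
  assumes c: "c > 0" and h: "h > 0" and m: "m > 0" and \<theta>: "0 \<le> \<theta>" "\<theta> < 1"
  shows "(\<integral>\<^sup>+\<omega>. ennreal (exp (\<theta> * energy c h m j (\<lambda>i. drift_increment c B h m i \<omega>))) \<partial>P)
    \<le> ennreal (tail_const \<theta> + 1 / sqrt (1 - \<theta>))"
proof (cases j)
  case 0
  have "ennreal (tail_const \<theta>) \<le> ennreal (tail_const \<theta> + 1 / sqrt (1 - \<theta>))"
    using \<theta> by (intro ennreal_leI) simp
  with nn_integral_exp_lindley_drift[OF c h m \<theta>, of 0 "m * m"] show ?thesis
    by (simp add: 0 mult.assoc del: ennreal_plus)
next
  case (Suc k)
  let ?L = "\<lambda>\<omega>. 2 * c * lindley (\<lambda>i. drift_increment c B h m i \<omega>) (block_start m k) m"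
  let ?X = "\<lambda>\<omega>. B (real (Suc k) * h) \<omega> - B (real k * h) \<omega>"
  have [measurable]: "?L \<in> borel_measurable P"
    by (intro borel_measurable_times borel_measurable_lindley) auto
  have d: "real (Suc k) * h - real k * h = h" by (simp add: algebra_simps)
  have X: "distributed P lborel ?X (normal_density 0 (sqrt h))"
    using normal_increments[of "real k * h" "real (Suc k) * h"] h unfolding d
    by (simp add: mult_strict_right_mono)
  have "(\<integral>\<^sup>+\<omega>. ennreal (exp (\<theta> * energy c h m j (\<lambda>i. drift_increment c B h m i \<omega>))) \<partial>P) \<le>
      (\<integral>\<^sup>+\<omega>. ennreal (exp (\<theta> * ?L \<omega>)) + ennreal (exp (\<theta> * ((?X \<omega>)\<^sup>2 / (2 * (sqrt h)\<^sup>2)))) \<partial>P)"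
  proof (rule nn_integral_mono)
    fix \<omega>
    have "energy c h m j (\<lambda>i. drift_increment c B h m i \<omega>) = max (?L \<omega>) ((?X \<omega>)\<^sup>2 / (2 * (sqrt h)\<^sup>2))"
      using h by (simp only: Suc energy.simps drift_block_sum[OF m] real_sqrt_pow2 less_imp_le)
    then show "ennreal (exp (\<theta> * energy c h m j (\<lambda>i. drift_increment c B h m i \<omega>))) \<le>
        ennreal (exp (\<theta> * ?L \<omega>)) + ennreal (exp (\<theta> * ((?X \<omega>)\<^sup>2 / (2 * (sqrt h)\<^sup>2))))"
      by (simp add: max_def del: ennreal_plus flip: ennreal_plus)
  qed
  also have "\<dots> = (\<integral>\<^sup>+\<omega>. ennreal (exp (\<theta> * ?L \<omega>)) \<partial>P) +
      (\<integral>\<^sup>+\<omega>. ennreal (exp (\<theta> * ((?X \<omega>)\<^sup>2 / (2 * (sqrt h)\<^sup>2)))) \<partial>P)"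
    by (rule nn_integral_add) measurable
  also have "\<dots> \<le> ennreal (tail_const \<theta>) + ennreal (1 / sqrt (1 - \<theta>))"
    using nn_integral_exp_lindley_drift[OF c h m \<theta>] h \<theta>
    by (intro add_mono eq_refl[OF nn_integral_normal_exp_square[OF _ _ X]]) auto
  also have "\<dots> = ennreal (tail_const \<theta> + 1 / sqrt (1 - \<theta>))"
    using \<theta> tail_const_pos[of \<theta>] by (intro ennreal_plus[symmetric]) auto
  finally show ?thesis .
qed

lemma prob_energy_ge:
  assumes c: "c > 0" and h: "h > 0" and m: "m > 0" and \<theta>: "0 \<le> \<theta>" "\<theta> < 1"
  shows "prob {\<omega> \<in> space P. x \<le> (\<Sum>j<N. energy c h m j (\<lambda>i. drift_increment c B h m i \<omega>))}
    \<le> (tail_const \<theta> + 1 / sqrt (1 - \<theta>)) ^ N * exp (- \<theta> * x)"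
proof (rule prob_sum_ge_le)
  \<comment> \<open>\<open>K j\<close> collects the grid increments entering the energy of block
    \<open>j\<close>; these sets are disjoint, hence the energies are independent.\<close>
  define K where "K j = (case j of 0 \<Rightarrow> {..<m * m} | Suc i \<Rightarrow> {block_start m i..<block_start m i + m})" for j
  show "indep_vars (\<lambda>_. borel) (\<lambda>j \<omega>. energy c h m j (\<lambda>i. drift_increment c B h m i \<omega>)) {..<N}"
  proof (rule indep_vars_functions_of_blocks[where K = K and X = "drift_increment c B h m" and f = "energy c h m"])
    show "indep_vars (\<lambda>_. borel) (drift_increment c B h m) {..<block_start m N}"
      by (rule indep_drift_increments[OF h m])
    show "K j \<subseteq> {..<block_start m N}" if "j \<in> {..<N}" for j
      using that block_start_mono[of "j - 1" N m] block_start_ge[of m N]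
      by (cases j) (auto simp: K_def)
    show "disjoint_family_on K {..<N}"
    unfolding disjoint_family_on_def
    proof (intro ballI impI)
      have "K i \<inter> K j = {}" if "i < j" for i j
        using that block_start_mono[of "i - 1" "j - 1" m] block_start_ge[of m "j - 1"]
        by (cases i; cases j) (auto simp: K_def)
      then show "K i \<inter> K j = {}" if "i \<noteq> j" for i j
        using that by (metis Int_commute nat_neq_iff)
    qed
    show "energy c h m j \<in> borel_measurable (PiM (K j) (\<lambda>_. borel))" if "j \<in> {..<N}" for j
    proof (cases j)
      case 0
      have "(\<lambda>g. 2 * c * lindley (\<lambda>i. g i) 0 (m * m)) \<in> borel_measurable (PiM (K j) (\<lambda>_. borel))"
        by (intro borel_measurable_times borel_measurable_lindley measurable_component_singleton)
           (auto simp: K_def 0)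
      also have "(\<lambda>g. 2 * c * lindley (\<lambda>i. g i) 0 (m * m)) = energy c h m j"
        by (simp add: 0 fun_eq_iff)
      finally show ?thesis .
    next
      case (Suc i)
      have "(\<lambda>g. max (2 * c * lindley (\<lambda>k. g k) (block_start m i) m)
          (((\<Sum>l<m. g (block_start m i + l)) + c * h)\<^sup>2 / (2 * h))) \<in> borel_measurable (PiM (K j) (\<lambda>_. borel))"
        by (intro borel_measurable_max borel_measurable_times borel_measurable_lindley
            borel_measurable_divide borel_measurable_power borel_measurable_add borel_measurable_sum
            borel_measurable_const measurable_component_singleton)
           (auto simp: K_def Suc)
      also have "(\<lambda>g. max (2 * c * lindley (\<lambda>k. g k) (block_start m i) m)
          (((\<Sum>l<m. g (block_start m i + l)) + c * h)\<^sup>2 / (2 * h))) = energy c h m j"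
        by (simp add: Suc fun_eq_iff)
      finally show ?thesis .
    qed
    show "energy c h m j (restrict g (K j)) = energy c h m j g" for j g
    proof (cases j)
      case 0
      then show ?thesis by (auto simp: K_def intro!: lindley_cong)
    next
      case (Suc i)
      have "lindley (restrict g (K j)) (block_start m i) m = lindley g (block_start m i) m"
        by (rule lindley_cong) (auto simp: K_def Suc)
      then show ?thesis by (simp add: K_def Suc)
    qed
  qed
  show "0 \<le> tail_const \<theta> + 1 / sqrt (1 - \<theta>)" using \<theta> tail_const_pos[of \<theta>] by (intro add_nonneg_nonneg) auto
qed (use nn_integral_exp_energy[OF c h m \<theta>] \<theta> in auto)

text \<open>By convexity, the exponential of a time average is at most the average of the
  exponentials, and \<open>exp (c * L)\<close> is the exponential moment of \<open>2 * c * L\<close>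
  at \<open>\<theta> = 1 / 2\<close>.\<close>

lemma prob_mean_block_lindley_ge:
  assumes c: "c > 0" and h: "h > 0" and m: "m > 0"
  shows "prob {\<omega> \<in> space P. x \<le> (\<Sum>j<N. mean_block_lindley m j (\<lambda>i. drift_increment c B h m i \<omega>))}
    \<le> tail_const (1 / 2) ^ N * exp (- c * x)"
proof (rule prob_sum_ge_le)
  let ?K = "\<lambda>j. {block_start m j..<block_start m j + m}"
  show "indep_vars (\<lambda>_. borel) (\<lambda>j \<omega>. mean_block_lindley m j (\<lambda>i. drift_increment c B h m i \<omega>)) {..<N}"
  proof (rule indep_vars_functions_of_blocks[where K = ?K and X = "drift_increment c B h m" and f = "mean_block_lindley m"])
    show "indep_vars (\<lambda>_. borel) (drift_increment c B h m) {..<block_start m N}"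
      by (rule indep_drift_increments[OF h m])
    show "?K j \<subseteq> {..<block_start m N}" if "j \<in> {..<N}" for j
      using that block_start_mono[of j N m] by auto
    show "disjoint_family_on ?K {..<N}"
    unfolding disjoint_family_on_def
    proof (intro ballI impI)
      have "?K i \<inter> ?K j = {}" if "i < j" for i j
        using block_start_mono[OF that, of m] by auto
      then show "?K i \<inter> ?K j = {}" if "i \<noteq> j" for i j
        using that by (metis Int_commute nat_neq_iff)
    qed
    show "mean_block_lindley m j \<in> borel_measurable (PiM (?K j) (\<lambda>_. borel))" for j
      unfolding mean_block_lindley_def
      by (intro borel_measurable_divide borel_measurable_sum borel_measurable_lindley
            borel_measurable_const measurable_component_singleton) auto
    show "mean_block_lindley m j (restrict g (?K j)) = mean_block_lindley m j g" for j g
      unfolding mean_block_lindley_def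
      by (intro arg_cong2[where f = "(/)"] sum.cong lindley_cong) auto
  qed
  show "(\<integral>\<^sup>+\<omega>. ennreal (exp (c * mean_block_lindley m j (\<lambda>i. drift_increment c B h m i \<omega>))) \<partial>P)
      \<le> ennreal (tail_const (1 / 2))" for j
  proof -
    let ?L = "\<lambda>k \<omega>. lindley (\<lambda>i. drift_increment c B h m i \<omega>) (block_start m j) k"
    have [measurable]: "?L k \<in> borel_measurable P" for k
      by (intro borel_measurable_lindley) auto
    have "(\<integral>\<^sup>+\<omega>. ennreal (exp (c * mean_block_lindley m j (\<lambda>i. drift_increment c B h m i \<omega>))) \<partial>P) \<le>
        (\<integral>\<^sup>+\<omega>. (\<Sum>k<m. ennreal (1 / real m) * ennreal (exp (1 / 2 * (2 * c * ?L k \<omega>)))) \<partial>P)"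
    proof (rule nn_integral_mono)
      fix \<omega>
      have "exp (\<Sum>k<m. (1 / real m) *\<^sub>R (c * ?L k \<omega>)) \<le> (\<Sum>k<m. (1 / real m) * exp (c * ?L k \<omega>))"
        using m exp_convex by (intro convex_on_sum[where C = UNIV]) auto
      also have "(\<Sum>k<m. (1 / real m) *\<^sub>R (c * ?L k \<omega>)) =
          c * mean_block_lindley m j (\<lambda>i. drift_increment c B h m i \<omega>)"
        by (simp add: mean_block_lindley_def sum_distrib_left sum_divide_distrib)
      finally show "ennreal (exp (c * mean_block_lindley m j (\<lambda>i. drift_increment c B h m i \<omega>))) \<le>
          (\<Sum>k<m. ennreal (1 / real m) * ennreal (exp (1 / 2 * (2 * c * ?L k \<omega>))))"
        by (simp add: ennreal_mult[symmetric] sum_ennreal ennreal_leI)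
    qed
    also have "\<dots> = (\<Sum>k<m. ennreal (1 / real m) * (\<integral>\<^sup>+\<omega>. ennreal (exp (1 / 2 * (2 * c * ?L k \<omega>))) \<partial>P))"
      by (subst nn_integral_sum) (auto simp: nn_integral_cmult)
    also have "\<dots> \<le> (\<Sum>k<m. ennreal (1 / real m) * ennreal (tail_const (1 / 2)))"
      by (intro sum_mono mult_left_mono nn_integral_exp_lindley_drift[OF c h m]) auto
    also have "\<dots> = ennreal (\<Sum>k<m. 1 / real m * tail_const (1 / 2))"
    proof -
      have "ennreal (1 / real m) * ennreal (tail_const (1 / 2)) = ennreal (1 / real m * tail_const (1 / 2))"
        using tail_const_pos[of "1 / 2"] by (intro ennreal_mult[symmetric]) auto
      moreover have "0 \<le> 1 / real m * tail_const (1 / 2)"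
        using tail_const_pos[of "1 / 2"] by simp
      ultimately show ?thesis by (simp only: sum_ennreal)
    qed
    also have "(\<Sum>k<m. 1 / real m * tail_const (1 / 2)) = tail_const (1 / 2)"
      using m by simp
    finally show ?thesis .
  qed
qed (use c tail_const_pos[of "1 / 2"] in auto)

text \<open>An area above \<open>a + b\<close> forces either the sum of averaged restarted workloads
  to reach \<open>b / h\<close> or the energy part to exceed \<open>a\<close>; the latter means
  energy at least \<open>x\<close>, as the quadratic is increasing. A union bound adds the two
  cases.\<close>

lemma prob_lindley_area_gt:
  assumes c: "c > 0" and h: "h > 0" and m: "m > 0" and \<theta>: "0 \<le> \<theta>" "\<theta> < 1" and x: "x \<ge> 0"
    and a: "3 / (8 * c ^ 3) * (x\<^sup>2 + 10 * c\<^sup>2 * h * x) \<le> a"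
  shows "prob {\<omega> \<in> space P. a + b < h / real m * (\<Sum>k<m * N. lindley (\<lambda>i. drift_increment c B h m i \<omega>) 0 (m * m + k))}
    \<le> (tail_const \<theta> + 1 / sqrt (1 - \<theta>)) ^ N * exp (- \<theta> * x) + tail_const (1 / 2) ^ N * exp (- c * (b / h))"
proof -
  let ?\<xi> = "\<lambda>\<omega> i. drift_increment c B h m i \<omega>"
  let ?E = "\<lambda>\<omega>. \<Sum>j<N. energy c h m j (?\<xi> \<omega>)"
  let ?Y = "\<lambda>\<omega>. \<Sum>j<N. mean_block_lindley m j (?\<xi> \<omega>)"
  have [measurable]: "(\<lambda>\<omega>. lindley (?\<xi> \<omega>) s k) \<in> borel_measurable P" for s k
    by (intro borel_measurable_lindley) auto
  have [measurable]: "(\<lambda>\<omega>. energy c h m j (?\<xi> \<omega>)) \<in> borel_measurable P" for j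
    by (cases j) auto
  have [measurable]: "(\<lambda>\<omega>. mean_block_lindley m j (?\<xi> \<omega>)) \<in> borel_measurable P" for j
    unfolding mean_block_lindley_def by measurable
  have "prob {\<omega> \<in> space P. a + b < h / real m * (\<Sum>k<m * N. lindley (?\<xi> \<omega>) 0 (m * m + k))}
      \<le> prob ({\<omega> \<in> space P. x \<le> ?E \<omega>} \<union> {\<omega> \<in> space P. b / h \<le> ?Y \<omega>})"
  proof (rule finite_measure_mono, safe)
    fix \<omega> assume \<omega>: "\<omega> \<in> space P" "\<not> b / h \<le> ?Y \<omega>"
      and *: "a + b < h / real m * (\<Sum>k<m * N. lindley (?\<xi> \<omega>) 0 (m * m + k))"
    have E0: "?E \<omega> \<ge> 0"
    proof (rule sum_nonneg)
      show "0 \<le> energy c h m j (?\<xi> \<omega>)" for j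
        using c by (cases j) (auto simp: lindley_nonneg le_max_iff_disj)
    qed
    have "h * ?Y \<omega> < b" using \<omega>(2) h by (simp add: field_simps)
    then have lt: "a < 3 / (8 * c ^ 3) * ((?E \<omega>)\<^sup>2 + 10 * c\<^sup>2 * h * ?E \<omega>)"
      using * lindley_area_le[OF c h m, of "?\<xi> \<omega>" N] by linarith
    show "x \<le> ?E \<omega>"
    proof (rule ccontr)
      assume "\<not> x \<le> ?E \<omega>"
      then have "?E \<omega> \<le> x" by simp
      then have "3 / (8 * c ^ 3) * ((?E \<omega>)\<^sup>2 + 10 * c\<^sup>2 * h * ?E \<omega>) \<le> 3 / (8 * c ^ 3) * (x\<^sup>2 + 10 * c\<^sup>2 * h * x)"
        using c h E0 by (intro mult_left_mono add_mono power_mono) auto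
      then show False using lt a by linarith
    qed
  qed measurable
  also have "\<dots> \<le> prob {\<omega> \<in> space P. x \<le> ?E \<omega>} + prob {\<omega> \<in> space P. b / h \<le> ?Y \<omega>}"
    by (rule measure_Un_le) measurable
  also have "\<dots> \<le> (tail_const \<theta> + 1 / sqrt (1 - \<theta>)) ^ N * exp (- \<theta> * x) + tail_const (1 / 2) ^ N * exp (- c * (b / h))"
    by (intro add_mono prob_energy_ge prob_mean_block_lindley_ge c h m \<theta>)
  finally show ?thesis .
qed

end

section \<open>Bounds for the area of the workload\<close>

context two_sided_brownian_motion
begin

lemmas path_lindley_bounded = lindley_bounded[where B = B, OF continuous_paths]
  and path_lindley_unbounded = lindley_unbounded[where B = B, OF continuous_paths]
  and path_area_tendsto = lindley_area_tendsto[where B = B, OF continuous_paths]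
  and path_workload_infinite = workload_not_finite_past[where B = B, OF continuous_paths]
  and path_workload_ge = workload_ge[where B = B, OF continuous_paths]
  and path_workload_nonneg = workload_nonneg[where B = B, OF continuous_paths]
  and path_workload_continuous = continuous_on_workload[where B = B, OF continuous_paths]

section \<open>Measurability and almost sure finiteness\<close>

lemma measurable_lindley_drift [measurable]:
  "(\<lambda>\<omega>. lindley (\<lambda>i. drift_increment c B h m i \<omega>) a k) \<in> borel_measurable P"
  by (intro borel_measurable_lindley) auto

text \<open>The walk at time 0 either stays bounded or tends to infinity as the grid grows, so
  \<open>finite_past\<close> can be expressed by countably many measurable functions.\<close>

lemma finite_past_iff:
  assumes \<omega>: "\<omega> \<in> space P"
  shows "finite_past c B \<omega> \<longleftrightarrow>
    (\<exists>K::nat. \<forall>n. \<exists>m\<ge>n. lindley (\<lambda>i. drift_increment c B 1 m i \<omega>) 0 (m * m) \<le> real K)"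
proof
  assume "finite_past c B \<omega>"
  then obtain K where K: "\<And>m. lindley (\<lambda>i. drift_increment c B 1 m i \<omega>) 0 (m * m) \<le> K"
    using path_lindley_bounded[OF \<omega>, of c 1] by auto
  obtain n :: nat where "K \<le> real n" using real_arch_simple by blast
  with K show "\<exists>K::nat. \<forall>n. \<exists>m\<ge>n. lindley (\<lambda>i. drift_increment c B 1 m i \<omega>) 0 (m * m) \<le> real K"
    by (meson order_refl order_trans)
next
  assume "\<exists>K::nat. \<forall>n. \<exists>m\<ge>n. lindley (\<lambda>i. drift_increment c B 1 m i \<omega>) 0 (m * m) \<le> real K"
  then obtain K :: nat where
    K: "\<And>n. \<exists>m\<ge>n. lindley (\<lambda>i. drift_increment c B 1 m i \<omega>) 0 (m * m) \<le> real K" by blast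
  show "finite_past c B \<omega>"
  proof (rule ccontr)
    assume "\<not> finite_past c B \<omega>"
    from path_lindley_unbounded[OF \<omega> this, of 1 "real K + 1"]
    obtain n where "\<And>m. m \<ge> n \<Longrightarrow> real K + 1 \<le> lindley (\<lambda>i. drift_increment c B 1 m i \<omega>) 0 (m * m)"
      unfolding eventually_sequentially by auto
    with K[of n] show False by fastforce
  qed
qed

lemma measurable_finite_past [measurable]: "Measurable.pred P (finite_past c B)"
proof -
  have "Measurable.pred P (\<lambda>\<omega>. \<exists>K::nat. \<forall>n. \<exists>m\<ge>n.
      lindley (\<lambda>i. drift_increment c B 1 m i \<omega>) 0 (m * m) \<le> real K)"
    by measurable
  then show ?thesis
    by (rule measurable_cong[THEN iffD1, rotated]) (simp add: finite_past_iff)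
qed

lemma prob_not_finite_past:
  assumes c: "c > 0"
  shows "prob {\<omega> \<in> space P. \<not> finite_past c B \<omega>} = 0"
proof (rule ccontr)
  let ?p = "prob {\<omega> \<in> space P. \<not> finite_past c B \<omega>}"
  assume "?p \<noteq> 0"
  then have p: "?p > 0" by (simp add: zero_less_measure_iff)
  \<comment> \<open>This \<open>x\<close> makes the tail bound equal to half of \<open>?p\<close>,
    although the walk eventually exceeds \<open>x\<close> on the whole event.\<close>
  define x where "x = - ln (?p / 2) / (2 * c)"
  have "?p \<le> exp (- (2 * c) * x)"
  proof (rule prob_le_of_eventually)
    let ?A = "\<lambda>m. {\<omega> \<in> space P. x \<le> lindley (\<lambda>i. drift_increment c B 1 m i \<omega>) 0 (m * m)}"
    show "?A m \<in> events" for m by measurable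
    show "{\<omega> \<in> space P. \<not> finite_past c B \<omega>} \<in> events" by measurable
    show "eventually (\<lambda>m. \<omega> \<in> ?A m) sequentially"
      if "\<omega> \<in> {\<omega> \<in> space P. \<not> finite_past c B \<omega>}" for \<omega>
      using that path_lindley_unbounded[of \<omega> c 1 x] by auto
    show "eventually (\<lambda>m. prob (?A m) \<le> exp (- (2 * c) * x)) sequentially"
      using eventually_gt_at_top[of 0]
      by eventually_elim (rule prob_lindley_drift_ge[OF c], auto)
  qed
  also have "exp (- (2 * c) * x) = ?p / 2"
    using c p by (simp add: x_def)
  finally show False using p by simp
qed

lemma measurable_area [measurable]:
  assumes T: "T > 0"
  shows "(\<lambda>\<omega>. LBINT r:{0..T}. workload c B r \<omega>) \<in> borel_measurable P"
proof (rule borel_measurable_LIMSEQ_real)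
  \<comment> \<open>A single block of length \<open>T\<close> is used. Where
    \<open>finite_past\<close> fails, the approximants are the constant \<open>?K\<close> to which
    the area reduces.\<close>
  let ?A = "\<lambda>m \<omega>. T / real m * (\<Sum>k<m. lindley (\<lambda>i. drift_increment c B T m i \<omega>) 0 (m * m + k))"
  let ?K = "LBINT r:{0..T}. (LEAST z::real. False)"
  show "(\<lambda>m. if finite_past c B \<omega> then ?A m \<omega> else ?K) \<longlonglongrightarrow> (LBINT r:{0..T}. workload c B r \<omega>)"
    if "\<omega> \<in> space P" for \<omega>
    using path_area_tendsto[OF that _ T, of c 1]
      path_workload_infinite[OF that]
    by (cases "finite_past c B \<omega>") simp_all
qed measurable

text \<open>The bound on the grid is free of \<open>m\<close>. As the inequality is strict, a sample
  in the event with a finite past satisfies it on all fine grids, so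
  \<open>prob_le_of_eventually\<close> passes to the limit.\<close>

lemma prob_area_gt_le:
  assumes c: "c > 0" and h: "h > 0" and N: "N > 0" and \<theta>: "0 \<le> \<theta>" "\<theta> < 1" and x: "x \<ge> 0"
    and a: "3 / (8 * c ^ 3) * (x\<^sup>2 + 10 * c\<^sup>2 * h * x) \<le> a"
  shows "prob {\<omega> \<in> space P. a + b < (LBINT r:{0..real N * h}. workload c B r \<omega>)}
    \<le> (tail_const \<theta> + 1 / sqrt (1 - \<theta>)) ^ N * exp (- \<theta> * x) + tail_const (1 / 2) ^ N * exp (- c * (b / h))"
    (is "prob ?S \<le> ?b")
proof -
  let ?A = "\<lambda>m \<omega>. h / real m * (\<Sum>k<m * N. lindley (\<lambda>i. drift_increment c B h m i \<omega>) 0 (m * m + k))"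
  let ?F = "{\<omega> \<in> space P. finite_past c B \<omega>}" and ?F' = "{\<omega> \<in> space P. \<not> finite_past c B \<omega>}"
  have Nh: "real N * h > 0" using N h by simp
  note [measurable] = measurable_area[OF Nh]
  have "prob ?S \<le> prob ((?S \<inter> ?F) \<union> ?F')"
    by (rule finite_measure_mono) auto
  also have "\<dots> \<le> prob (?S \<inter> ?F) + prob ?F'"
    by (rule measure_Un_le) measurable
  also have "prob ?F' = 0" by (rule prob_not_finite_past[OF c])
  also have "prob (?S \<inter> ?F) \<le> ?b"
  proof (rule prob_le_of_eventually)
    show "{\<omega> \<in> space P. a + b < ?A m \<omega>} \<in> events" for m by measurable
    show "?S \<inter> ?F \<in> events" by measurable
    show "eventually (\<lambda>m. \<omega> \<in> {\<omega> \<in> space P. a + b < ?A m \<omega>}) sequentially"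
      if "\<omega> \<in> ?S \<inter> ?F" for \<omega>
    proof -
      from that have \<omega>: "\<omega> \<in> space P" "finite_past c B \<omega>"
        and gt: "a + b < (LBINT r:{0..real N * h}. workload c B r \<omega>)" by auto
      have "eventually (\<lambda>m. a + b < ?A m \<omega>) sequentially"
        by (rule order_tendstoD(1)[OF path_area_tendsto[OF \<omega> h N] gt])
      then show ?thesis using \<omega> by simp
    qed
    show "eventually (\<lambda>m. prob {\<omega> \<in> space P. a + b < ?A m \<omega>} \<le> ?b) sequentially"
      using eventually_gt_at_top[of 0]
      by eventually_elim (rule prob_lindley_area_gt[OF c h _ \<theta> x a])
  qed
  finally show ?thesis by simp
qed

lemma area_ge_brownian_area:
  assumes \<omega>: "\<omega> \<in> space P" and fin: "finite_past c B \<omega>" and L: "0 < L" "L \<le> T"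
  shows "(LBINT r:{0..L}. B r \<omega>) - c * L\<^sup>2 / 2 \<le> (LBINT r:{0..T}. workload c B r \<omega>)"
proof -
  let ?Q = "\<lambda>t. workload c B t \<omega>" and ?B = "\<lambda>t. B t \<omega>"
  have cQ: "continuous_on {a..b} ?Q" for a b
    by (rule path_workload_continuous[OF \<omega> fin])
  have cB: "continuous_on {a..b} ?B" for a b
    using continuous_paths[OF \<omega>] by (rule continuous_on_subset) auto
  have eq: "(LBINT r:{a..b}. f r) = integral {a..b} f" if "continuous_on {a..b} f" for a b :: real and f :: "real \<Rightarrow> real"
    using borel_integrable_atLeastAtMost'[OF that] by (rule set_borel_integral_eq_integral)
  have "integral {0..L} ?B - c * L\<^sup>2 / 2 = integral {0..L} (\<lambda>t. ?B t - c * t)"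
  proof -
    have "((\<lambda>t. c * t) has_integral c * ((L\<^sup>2 - 0\<^sup>2) / 2)) {0..L}"
      using L by (intro has_integral_mult_right ident_has_integral) auto
    then have "((\<lambda>t. ?B t - c * t) has_integral (integral {0..L} ?B - c * ((L\<^sup>2 - 0\<^sup>2) / 2))) {0..L}"
      by (intro has_integral_diff integrable_integral integrable_continuous_real cB)
    then show ?thesis by (simp add: integral_unique)
  qed
  also have "\<dots> \<le> integral {0..L} ?Q"
  proof (rule integral_le)
    show "?B t - c * t \<le> ?Q t" if "t \<in> {0..L}" for t
      using path_workload_ge[OF \<omega> fin, of 0 t] that start_zero[OF \<omega>] by simp
  qed (intro integrable_continuous_real continuous_intros cB cQ)+
  also have "\<dots> \<le> integral {0..L} ?Q + integral {L..T} ?Q"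
    using path_workload_nonneg[OF \<omega> fin]
    by (simp add: Henstock_Kurzweil_Integration.integral_nonneg integrable_continuous_real cQ)
  also have "\<dots> = integral {0..T} ?Q"
    using L by (intro Henstock_Kurzweil_Integration.integral_combine integrable_continuous_real cQ) auto
  finally show ?thesis by (simp add: eq cQ cB)
qed

text \<open>Summation by parts writes the sum as a combination of independent increments with
  weights \<open>m, ..., 1\<close>. The right endpoint is included so that, after scaling, the
  variance is at least \<open>L ^ 3 / 3\<close>, that of the Brownian area, for every
  \<open>m\<close>.\<close>

lemma prob_brownian_sum_ge:
  assumes L: "L > 0" and m: "m > 0" and y: "y \<ge> 0"
  shows "exp (- (y / sqrt (L ^ 3 / 3) + 1)\<^sup>2 / 2) / sqrt (2 * pi) \<le>
    prob {\<omega> \<in> space P. y \<le> L / real m * (\<Sum>k<Suc m. B (real k * (L / real m)) \<omega>)}"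
proof -
  define d where "d = L / real m"
  have d: "d > 0" "real m * d = L" using L m by (auto simp: d_def)
  let ?D = "\<lambda>i \<omega>. B (real (Suc i) * d) \<omega> - B (real i * d) \<omega>"
  let ?Y = "\<lambda>i \<omega>. 0 + d * (real m - real i) * ?D i \<omega>"
  define \<sigma> where "\<sigma> = sqrt (\<Sum>i<m. (\<bar>d * (real m - real i)\<bar> * sqrt d)\<^sup>2)"
  have ind: "indep_vars (\<lambda>_. borel) ?D {..<m}"
    using d by (intro indep_increments) (auto simp: strict_mono_on_def)
  have Y: "distributed P lborel (?Y i) (normal_density (0 + d * (real m - real i) * 0) (\<bar>d * (real m - real i)\<bar> * sqrt d))"
    if "i < m" for i
  proof (rule normal_density_affine)
    have "real (Suc i) * d - real i * d = d" by (simp add: algebra_simps)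
    then show "distributed P lborel (?D i) (normal_density 0 (sqrt d))"
      using normal_increments[of "real i * d" "real (Suc i) * d"] d by simp
  qed (use d that in auto)
  have "distributed P lborel (\<lambda>\<omega>. \<Sum>i<m. ?Y i \<omega>)
      (normal_density (\<Sum>i<m. 0 + d * (real m - real i) * 0) (sqrt (\<Sum>i<m. (\<bar>d * (real m - real i)\<bar> * sqrt d)\<^sup>2)))"
  proof (rule sum_indep_normal)
    show "indep_vars (\<lambda>_. borel) ?Y {..<m}"
      using ind by (rule indep_vars_compose2) auto
  qed (use m d Y in auto)
  then have N: "distributed P lborel (\<lambda>\<omega>. \<Sum>i<m. ?Y i \<omega>) (normal_density 0 \<sigma>)"
    by (simp add: \<sigma>_def)
  have "L ^ 3 / 3 \<le> (\<Sum>i<m. (\<bar>d * (real m - real i)\<bar> * sqrt d)\<^sup>2)"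
  proof -
    have cube: "real m ^ 3 / 3 \<le> (\<Sum>i<m. (real (Suc i))\<^sup>2)"
    proof (induction m)
      case (Suc m)
      have "real (Suc m) ^ 3 / 3 \<le> real m ^ 3 / 3 + (real (Suc m))\<^sup>2"
        by (simp add: field_simps power2_eq_square power3_eq_cube)
      with Suc show ?case by simp
    qed simp
    have "L ^ 3 / 3 = d ^ 3 * (real m ^ 3 / 3)"
      unfolding d(2)[symmetric] by (simp add: power_mult_distrib)
    also have "\<dots> \<le> d ^ 3 * (\<Sum>i<m. (real (Suc i))\<^sup>2)"
      using d cube by (intro mult_left_mono) auto
    also have "(\<Sum>i<m. (real (Suc i))\<^sup>2) = (\<Sum>i<m. (real m - real i)\<^sup>2)"
      by (subst sum.nat_diff_reindex[symmetric], rule sum.cong) (auto simp: of_nat_diff)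
    also have "d ^ 3 * \<dots> = (\<Sum>i<m. (\<bar>d * (real m - real i)\<bar> * sqrt d)\<^sup>2)"
      using d by (simp add: power_mult_distrib sum_distrib_left) (simp add: power2_eq_square power3_eq_cube mult_ac)
    finally show ?thesis .
  qed
  then have \<sigma>: "sqrt (L ^ 3 / 3) \<le> \<sigma>" "sqrt (L ^ 3 / 3) > 0" using L by (simp_all add: \<sigma>_def)
  have "exp (- (y / sqrt (L ^ 3 / 3) + 1)\<^sup>2 / 2) / sqrt (2 * pi) \<le> prob {\<omega> \<in> space P. y \<le> (\<Sum>i<m. ?Y i \<omega>)}"
    using \<sigma> by (intro prob_normal_ge[OF less_le_trans[OF \<sigma>(2,1)] _ _ y N])
  also have "{\<omega> \<in> space P. y \<le> (\<Sum>i<m. ?Y i \<omega>)} =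
      {\<omega> \<in> space P. y \<le> L / real m * (\<Sum>k<Suc m. B (real k * (L / real m)) \<omega>)}"
  proof (rule Collect_cong, rule conj_cong[OF refl])
    fix \<omega> assume \<omega>: "\<omega> \<in> space P"
    have "(\<Sum>k<Suc m. B (real k * d) \<omega>) = (\<Sum>k<Suc m. \<Sum>i<k. ?D i \<omega>)"
      using start_zero[OF \<omega>] sum_lessThan_telescope[of "\<lambda>i. B (real i * d) \<omega>"]
      by (intro sum.cong) auto
    also have "\<dots> = (\<Sum>i<Suc m. (real m - real i) * ?D i \<omega>)"
      using sum_partial_sums[of "\<lambda>i. ?D i \<omega>" "Suc m"] by simp
    also have "\<dots> = (\<Sum>i<m. (real m - real i) * ?D i \<omega>)" by simp
    finally show "(y \<le> (\<Sum>i<m. ?Y i \<omega>)) = (y \<le> L / real m * (\<Sum>k<Suc m. B (real k * (L / real m)) \<omega>))"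
      by (simp add: d_def[symmetric] sum_distrib_left mult.assoc)
  qed
  finally show ?thesis .
qed

lemma prob_area_gt_ge:
  assumes c: "c > 0" and L: "0 < L" "L \<le> T" and y: "y \<ge> 0"
  shows "exp (- ((y + c * L\<^sup>2 / 2 + 1) / sqrt (L ^ 3 / 3) + 1)\<^sup>2 / 2) / sqrt (2 * pi) \<le>
    prob {\<omega> \<in> space P. y < (LBINT r:{0..T}. workload c B r \<omega>)}" (is "?b \<le> prob ?S")
proof -
  \<comment> \<open>The drift takes away the area \<open>c L^2 / 2\<close>; the extra 1 makes the
    limiting inequality strict, so a sample with a finite past and area at most \<open>y\<close>
    eventually leaves the events.\<close>
  define z where "z = y + c * L\<^sup>2 / 2 + 1"
  have z: "z \<ge> 0" using c y by (simp add: z_def)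
  let ?R = "\<lambda>m \<omega>. L / real m * (\<Sum>k<Suc m. B (real k * (L / real m)) \<omega>)"
  let ?F' = "{\<omega> \<in> space P. \<not> finite_past c B \<omega>}"
  have [measurable]: "(\<lambda>\<omega>. LBINT r:{0..T}. workload c B r \<omega>) \<in> borel_measurable P"
    using L by (intro measurable_area) auto
  have "?b \<le> prob (?S \<union> ?F')"
  proof (rule prob_ge_of_infinitely_often)
    show "{\<omega> \<in> space P. z \<le> ?R m \<omega>} \<in> events" for m by measurable
    show "?S \<union> ?F' \<in> events" by measurable
    show "eventually (\<lambda>m. \<omega> \<notin> {\<omega> \<in> space P. z \<le> ?R m \<omega>}) sequentially"
      if \<omega>: "\<omega> \<in> space P" and "\<omega> \<notin> ?S \<union> ?F'" for \<omega>
    proof -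
      from that have fin: "finite_past c B \<omega>" and le: "(LBINT r:{0..T}. workload c B r \<omega>) \<le> y"
        by auto
      have lt: "(LBINT r:{0..L}. B r \<omega>) + 0 < z"
        using area_ge_brownian_area[OF \<omega> fin L] le by (simp add: z_def)
      have "(\<lambda>m. L / real m * (\<Sum>k<m. B (real k * (L / real m)) \<omega>)) \<longlonglongrightarrow> (LBINT r:{0..L}. B r \<omega>)"
        using L continuous_on_subset[OF continuous_paths[OF \<omega>]] by (intro riemann_sum_tendsto) auto
      moreover have "(\<lambda>m. L * B L \<omega> / real m) \<longlonglongrightarrow> 0"
        by (rule lim_const_over_n)
      ultimately have "(\<lambda>m. L / real m * (\<Sum>k<m. B (real k * (L / real m)) \<omega>) + L * B L \<omega> / real m)
          \<longlonglongrightarrow> (LBINT r:{0..L}. B r \<omega>) + 0"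
        by (rule tendsto_add)
      from order_tendstoD(2)[OF this lt] eventually_gt_at_top[of 0]
      show ?thesis
      proof eventually_elim
        case (elim m)
        have "?R m \<omega> = L / real m * (\<Sum>k<m. B (real k * (L / real m)) \<omega>) + L * B L \<omega> / real m"
          using elim(2) by (simp add: distrib_left)
        then show ?case using elim(1) by simp
      qed
    qed
    show "eventually (\<lambda>m. ?b \<le> prob {\<omega> \<in> space P. z \<le> ?R m \<omega>}) sequentially"
      using eventually_gt_at_top[of 0]
      by eventually_elim (unfold z_def[symmetric], rule prob_brownian_sum_ge[OF L(1) _ z])
  qed
  also have "\<dots> \<le> prob ?S + prob ?F'"
    by (rule measure_Un_le) measurable
  finally show ?thesis using prob_not_finite_past[OF c] by simp
qed

end

section \<open>Logarithmic asymptotics\<close>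

text \<open>For positive \<open>c\<close> and \<open>M\<close>, the positive root \<open>x\<close>
  of \<open>3 x^2 / (8 c^3) = M\<close>: to leading order, the area \<open>M u\<close> requires
  energy \<open>x * sqrt u\<close>.\<close>

definition decay_rate :: "real \<Rightarrow> real \<Rightarrow> real" where
  "decay_rate c M = 2 / 3 * sqrt 6 * c * sqrt (c * M)"

lemma decay_rate_pos: "c > 0 \<Longrightarrow> M > 0 \<Longrightarrow> decay_rate c M > 0"
  by (simp add: decay_rate_def)

lemma decay_rate_squared:
  assumes "c > 0" "M > 0"
  shows "3 / (8 * c ^ 3) * (decay_rate c M)\<^sup>2 = M"
proof -
  have eq: "(decay_rate c M)\<^sup>2 = 8 / 3 * c ^ 3 * M"
    using assms unfolding decay_rate_def power_mult_distrib
    by (simp add: power2_eq_square power3_eq_cube)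
  show ?thesis using assms unfolding eq by simp
qed

context two_sided_brownian_motion
begin

lemma eventually_prob_area_ge:
  assumes c: "c > 0" and M: "M > 0" and Tpos: "\<And>u. T u > 0"
    and T: "(\<lambda>u. sqrt u) \<in> o[at_top](T)" and \<kappa>: "\<kappa> > decay_rate c M"
  shows "eventually (\<lambda>u. exp (- \<kappa> * sqrt u) \<le>
    prob {\<omega> \<in> space P. M * u < (LBINT r:{0..T u}. workload c B r \<omega>)}) at_top"
proof -
  \<comment> \<open>\<open>\<tau>\<close> minimises \<open>(M + c \<tau>\<^sup>2 / 2)\<^sup>2 / (2 \<tau>\<^sup>3 / 3)\<close>, the cost of sweeping out the area \<open>M u\<close>
    within time \<open>\<tau> sqrt u\<close>.\<close>
  define \<tau> where "\<tau> = sqrt (6 * M / c)"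
  have \<tau>: "\<tau> > 0" "\<tau>\<^sup>2 = 6 * M / c" using c M by (auto simp: \<tau>_def)
  define k where "k = \<tau> ^ 3 / 3"
  have k: "k > 0" using \<tau> by (simp add: k_def)
  \<comment> \<open>Since \<open>c \<tau>^2 / 2 = 3 M\<close>, the minimal cost is
    \<open>(4 M)^2 / (2 k) = 8 M^2 / k\<close>. Comparing squares removes the roots.\<close>
  have rate: "8 * M\<^sup>2 / k = decay_rate c M"
  proof -
    have "(8 * M\<^sup>2 / k)\<^sup>2 = (24 * M\<^sup>2)\<^sup>2 / (\<tau>\<^sup>2) ^ 3"
      by (simp add: k_def power_divide power2_eq_square power3_eq_cube)
    also have "\<dots> = 8 / 3 * c ^ 3 * M"
      unfolding \<tau>(2) using c M by (simp add: power_divide power2_eq_square power3_eq_cube)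
    also have "\<dots> = (decay_rate c M)\<^sup>2"
      using decay_rate_squared[OF c M] c by (simp add: field_simps)
    finally show ?thesis
      using decay_rate_pos[OF c M] k by (simp add: power2_eq_iff_nonneg)
  qed
  \<comment> \<open>The Gaussian exponent for \<open>L = \<tau> sqrt u\<close>, with its prefactor,
    divided by \<open>sqrt u\<close>; both shifts by 1 disappear in the limit.\<close>
  have "((\<lambda>u. (((4 * M * u + 1) / sqrt (k * (u * sqrt u)) + 1)\<^sup>2 / 2 + ln (sqrt (2 * pi))) / sqrt u)
      \<longlongrightarrow> 8 * M\<^sup>2 / k) at_top"
    using M k by (real_asymp simp: field_simps power2_eq_square powr_half_sqrt)
  then have lim: "eventually (\<lambda>u. (((4 * M * u + 1) / sqrt (k * (u * sqrt u)) + 1)\<^sup>2 / 2 + ln (sqrt (2 * pi))) / sqrt u < \<kappa>) at_top"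
    using \<kappa> unfolding rate by (rule order_tendstoD)
  \<comment> \<open>This makes the window \<open>[0, \<tau> sqrt u]\<close> fit into
    \<open>[0, T u]\<close>.\<close>
  have "eventually (\<lambda>u. norm (sqrt u) \<le> 1 / \<tau> * norm (T u)) at_top"
    using landau_o.smallD[OF T, of "1 / \<tau>"] \<tau> by simp
  with lim eventually_gt_at_top[of 0] show ?thesis
  proof eventually_elim
    case (elim u)
    define L where "L = \<tau> * sqrt u"
    have L: "0 < L" "L \<le> T u"
      using elim(2,3) \<tau> Tpos[of u] by (auto simp: L_def field_simps)
    have "c * L\<^sup>2 / 2 = 3 * (M * u)"
      using \<tau>(2) elim(2) c by (simp add: L_def power_mult_distrib)
    then have z: "M * u + c * L\<^sup>2 / 2 + 1 = 4 * M * u + 1" by simp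
    have "L ^ 3 / 3 = k * (sqrt u) ^ 3" by (simp add: L_def k_def power_mult_distrib)
    also have "(sqrt u) ^ 3 = u * sqrt u" using elim(2) by (simp add: power3_eq_cube)
    finally have L3: "L ^ 3 / 3 = k * (u * sqrt u)" .
    let ?g = "((4 * M * u + 1) / sqrt (k * (u * sqrt u)) + 1)\<^sup>2 / 2"
    have "?g + ln (sqrt (2 * pi)) < \<kappa> * sqrt u"
      using elim(1,2) by (simp add: field_simps)
    then have "exp (- \<kappa> * sqrt u) \<le> exp (- ?g - ln (sqrt (2 * pi)))"
      by simp
    also have "\<dots> = exp (- ?g) / sqrt (2 * pi)"
      by (simp add: exp_diff)
    also have "\<dots> \<le> prob {\<omega> \<in> space P. M * u < (LBINT r:{0..T u}. workload c B r \<omega>)}"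
      using prob_area_gt_ge[OF c L, of "M * u"] M elim(2) unfolding z L3 by simp
    finally show ?case .
  qed
qed

lemma eventually_prob_area_le:
  assumes c: "c > 0" and M: "M > 0" and Tpos: "\<And>u. T u > 0"
    and T: "T \<in> o[at_top](\<lambda>u. u)" and \<kappa>: "0 < \<kappa>" "\<kappa> < decay_rate c M"
  shows "eventually (\<lambda>u. prob {\<omega> \<in> space P. M * u < (LBINT r:{0..T u}. workload c B r \<omega>)}
    \<le> exp (- \<kappa> * sqrt u)) at_top"
proof -
  \<comment> \<open>The gap between \<open>\<kappa>\<close> and the decay rate is spent three times:
    \<open>\<kappa>1\<close> below the decay rate leaves spare area,
    \<open>\<kappa>2 = \<theta> \<kappa>1\<close> allows an exponential moment of order
    \<open>\<theta> < 1\<close>, and \<open>\<kappa>2 - \<kappa>\<close> absorbs the growth of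
    \<open>C ^ N\<close>.\<close>
  define \<kappa>1 where "\<kappa>1 = (\<kappa> + decay_rate c M) / 2"
  define \<kappa>2 where "\<kappa>2 = (\<kappa> + \<kappa>1) / 2"
  have k: "\<kappa> < \<kappa>2" "\<kappa>2 < \<kappa>1" "\<kappa>1 < decay_rate c M" "0 < \<kappa>1" "0 < \<kappa>2"
  proof -
    have "\<kappa> < \<kappa>1" "\<kappa>1 < decay_rate c M" using \<kappa> by (simp_all add: \<kappa>1_def)
    then show "\<kappa> < \<kappa>2" "\<kappa>2 < \<kappa>1" "\<kappa>1 < decay_rate c M" "0 < \<kappa>1" "0 < \<kappa>2"
      using \<kappa> by (simp_all add: \<kappa>2_def)
  qed
  define \<theta> where "\<theta> = \<kappa>2 / \<kappa>1"
  have \<theta>: "0 \<le> \<theta>" "\<theta> < 1" "\<theta> * \<kappa>1 = \<kappa>2" using k by (auto simp: \<theta>_def)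
  define q where "q = 3 / (8 * c ^ 3)"
  have q: "q > 0" using c by (simp add: q_def)
  \<comment> \<open>The spare area \<open>M - q \<kappa>1^2\<close> is halved: one half covers the
    term linear in the energy, the other the restarted workloads.\<close>
  define \<eta> where "\<eta> = (M - q * \<kappa>1\<^sup>2) / 2"
  have "q * \<kappa>1\<^sup>2 < q * (decay_rate c M)\<^sup>2"
    using k q by (intro mult_strict_left_mono power_strict_mono) auto
  then have \<eta>: "\<eta> > 0" "q * \<kappa>1\<^sup>2 + \<eta> = M - \<eta>"
    using decay_rate_squared[OF c M] by (auto simp: \<eta>_def q_def field_simps)
  \<comment> \<open>For blocks with \<open>h \<le> \<delta> sqrt u\<close>, the first bound keeps
    the linear term below \<open>\<eta> u\<close>, and the second gives
    \<open>exp (- c \<eta> u / h) \<le> exp (- \<kappa>2 sqrt u)\<close>.\<close>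
  define \<delta> where "\<delta> = min (\<eta> / (q * (10 * c\<^sup>2 * \<kappa>1))) (c * \<eta> / \<kappa>2)"
  have \<delta>: "\<delta> > 0" using q c k \<eta> by (simp add: \<delta>_def)
  have \<delta>1: "q * (10 * c\<^sup>2 * \<kappa>1) * \<delta> \<le> \<eta>"
  proof -
    have "0 < q * (10 * c\<^sup>2 * \<kappa>1)" using q c k by simp
    moreover have "\<delta> \<le> \<eta> / (q * (10 * c\<^sup>2 * \<kappa>1))" by (simp add: \<delta>_def)
    ultimately show ?thesis by (simp only: pos_le_divide_eq mult.commute)
  qed
  have \<delta>2: "\<kappa>2 * \<delta> \<le> c * \<eta>"
  proof -
    have "\<delta> \<le> c * \<eta> / \<kappa>2" by (simp add: \<delta>_def)
    then show ?thesis using k(5) by (simp only: pos_le_divide_eq mult.commute)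
  qed
  define C where "C = max 1 (max (tail_const \<theta> + 1 / sqrt (1 - \<theta>)) (tail_const (1 / 2)))"
  have C: "C \<ge> 1" "tail_const \<theta> + 1 / sqrt (1 - \<theta>) \<le> C" "tail_const (1 / 2) \<le> C"
    by (auto simp: C_def)
  \<comment> \<open>Chosen so that \<open>\<epsilon> sqrt u\<close> blocks cost at most half of
    \<open>\<kappa>2 - \<kappa>\<close>; the \<open>+ 1\<close> avoids a zero denominator when
    \<open>C = 1\<close>.\<close>
  define \<epsilon> where "\<epsilon> = (\<kappa>2 - \<kappa>) / (2 * (ln C + 1))"
  have lnC: "ln C \<ge> 0" using C by simp
  have \<epsilon>: "\<epsilon> > 0" "\<epsilon> * ln C \<le> (\<kappa>2 - \<kappa>) / 2"
    using lnC k by (auto simp: \<epsilon>_def field_simps)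
  have "eventually (\<lambda>u. norm (T u) \<le> \<epsilon> * \<delta> * norm u) at_top"
    using landau_o.smallD[OF T, of "\<epsilon> * \<delta>"] \<epsilon> \<delta> by simp
  moreover have "eventually (\<lambda>u. (\<kappa>2 - \<kappa>) / 2 * sqrt u \<ge> ln 2 + ln C) at_top"
    using k by real_asymp
  ultimately show ?thesis using eventually_gt_at_top[of 0]
  proof eventually_elim
    case (elim u)
    define v where "v = sqrt u"
    have v: "v > 0" "u = v\<^sup>2" using elim by (auto simp: v_def)
    \<comment> \<open>Rounding up keeps \<open>h = T u / N\<close> at most \<open>\<delta> v\<close>
      while the blocks tile \<open>[0, T u]\<close> exactly. The price is at most one extra block,
      which accounts for the separate \<open>ln C\<close> in the final estimate.\<close>
    define N where "N = nat \<lceil>T u / (\<delta> * v)\<rceil>"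
    have Tv: "T u / (\<delta> * v) > 0" using Tpos[of u] \<delta> v by simp
    then have N: "N > 0" "T u / (\<delta> * v) \<le> real N" "real N \<le> T u / (\<delta> * v) + 1"
      unfolding N_def by linarith+
    define h where "h = T u / real N"
    have h: "h > 0" "real N * h = T u" using N Tpos[of u] by (auto simp: h_def)
    have hv: "h \<le> \<delta> * v"
      using N \<delta> v by (simp add: h_def field_simps)
    have Nv: "real N \<le> \<epsilon> * v + 1"
    proof -
      have "T u \<le> \<epsilon> * \<delta> * v\<^sup>2" using elim(1) v by simp
      then have "T u / (\<delta> * v) \<le> \<epsilon> * v"
        using \<delta> v by (simp add: field_simps power2_eq_square)
      then show ?thesis using N by simp
    qed
    have a: "3 / (8 * c ^ 3) * ((\<kappa>1 * v)\<^sup>2 + 10 * c\<^sup>2 * h * (\<kappa>1 * v)) \<le> (M - \<eta>) * u"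
    proof -
      have "q * ((\<kappa>1 * v)\<^sup>2 + 10 * c\<^sup>2 * h * (\<kappa>1 * v)) \<le> q * ((\<kappa>1 * v)\<^sup>2 + 10 * c\<^sup>2 * (\<delta> * v) * (\<kappa>1 * v))"
        using q hv k v by (intro mult_left_mono add_left_mono mult_right_mono) auto
      also have "\<dots> = (q * \<kappa>1\<^sup>2 + q * (10 * c\<^sup>2 * \<kappa>1) * \<delta>) * v\<^sup>2"
        by (simp add: algebra_simps power2_eq_square)
      also have "\<dots> \<le> (q * \<kappa>1\<^sup>2 + \<eta>) * v\<^sup>2"
        using \<delta>1 by (intro mult_right_mono add_left_mono) auto
      finally show ?thesis unfolding \<eta>(2) by (simp add: q_def v)
    qed
    have small: "exp (- c * (\<eta> * u / h)) \<le> exp (- \<kappa>2 * v)"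
    proof -
      have "\<kappa>2 * v * h \<le> \<kappa>2 * v * (\<delta> * v)"
        using hv k v by (intro mult_left_mono) auto
      also have "\<dots> = (\<kappa>2 * \<delta>) * v\<^sup>2" by (simp add: power2_eq_square)
      also have "\<dots> \<le> c * \<eta> * v\<^sup>2" using \<delta>2 by (intro mult_right_mono) auto
      finally have "\<kappa>2 * v \<le> c * \<eta> * v\<^sup>2 / h" using h by (simp add: pos_le_divide_eq)
      then show ?thesis by (simp add: v mult.assoc)
    qed
    have "prob {\<omega> \<in> space P. M * u < (LBINT r:{0..T u}. workload c B r \<omega>)} =
        prob {\<omega> \<in> space P. (M - \<eta>) * u + \<eta> * u < (LBINT r:{0..real N * h}. workload c B r \<omega>)}"
      unfolding h(2) by (simp add: algebra_simps)
    also have "\<dots> \<le> (tail_const \<theta> + 1 / sqrt (1 - \<theta>)) ^ N * exp (- \<theta> * (\<kappa>1 * v)) +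
        tail_const (1 / 2) ^ N * exp (- c * (\<eta> * u / h))"
      using k v by (intro prob_area_gt_le c h(1) N(1) \<theta>(1,2) a) auto
    also have "\<dots> \<le> C ^ N * exp (- \<kappa>2 * v) + C ^ N * exp (- \<kappa>2 * v)"
    proof -
      have e: "exp (- \<theta> * (\<kappa>1 * v)) = exp (- \<kappa>2 * v)" using \<theta>(3) by (simp flip: mult.assoc)
      have p: "0 \<le> tail_const \<theta> + 1 / sqrt (1 - \<theta>)" "0 \<le> tail_const (1 / 2)"
        using tail_const_pos[of \<theta>] tail_const_pos[of "1 / 2"] \<theta> by auto
      show ?thesis
        unfolding e using C small p by (intro add_mono mult_mono power_mono) auto
    qed
    also have "\<dots> = exp (ln 2 + real N * ln C - \<kappa>2 * v)"
      using C by (simp add: exp_add exp_diff exp_of_nat_mult exp_minus field_simps)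
    also have "\<dots> \<le> exp (- \<kappa> * v)"
    proof -
      have "real N * ln C \<le> (\<epsilon> * v + 1) * ln C" using Nv lnC by (intro mult_right_mono)
      also have "\<dots> = (\<epsilon> * ln C) * v + ln C" by (simp add: algebra_simps)
      also have "\<dots> \<le> (\<kappa>2 - \<kappa>) / 2 * v + ln C"
        using \<epsilon> v by (intro add_right_mono mult_right_mono) auto
      finally have "ln 2 + real N * ln C - \<kappa>2 * v \<le> (\<kappa>2 - \<kappa>) / 2 * v + (\<kappa>2 - \<kappa>) / 2 * v - \<kappa>2 * v"
        using elim(2) unfolding v_def by linarith
      also have "\<dots> = - \<kappa> * v" by (simp add: field_simps)
      finally show ?thesis by simp
    qed
    finally show ?case by (simp add: v_def)
  qed
qed

end

theorem theorem3:
  fixes P :: "'a measure" and B :: "real \<Rightarrow> 'a \<Rightarrow> real"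
    and c M :: real and T :: "real \<Rightarrow> real"
  assumes "two_sided_brownian_motion P B"
    and "c > 0"
    and "M > 0"
    and "\<And>u. T u > 0"
    and "(\<lambda>u. sqrt u) \<in> o[at_top](T)"
    and "T \<in> o[at_top](\<lambda>u. u)"
  shows "((\<lambda>u. 1 / sqrt u *
            ln (measure P {\<omega> \<in> space P. (LBINT r:{0..T u}. workload c B r \<omega>) > M * u}))
          \<longlongrightarrow> - (2 / 3) * sqrt 6 * c * sqrt (c * M)) at_top"
proof -
  interpret two_sided_brownian_motion P B by fact
  let ?p = "\<lambda>u. prob {\<omega> \<in> space P. M * u < (LBINT r:{0..T u}. workload c B r \<omega>)}"
  have limit: "- (2 / 3) * sqrt 6 * c * sqrt (c * M) = - decay_rate c M"
    by (simp add: decay_rate_def)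
  note lower = eventually_prob_area_ge[OF assms(2-5)]
  note upper = eventually_prob_area_le[OF assms(2-4,6)]
  have "((\<lambda>u. 1 / sqrt u * ln (?p u)) \<longlongrightarrow> - decay_rate c M) at_top"
  proof (rule order_tendstoI)
    fix a assume "a < - decay_rate c M"
    then obtain \<kappa> where \<kappa>: "decay_rate c M < \<kappa>" "\<kappa> < - a"
      using dense[of "decay_rate c M" "- a"] by auto
    show "eventually (\<lambda>u. a < 1 / sqrt u * ln (?p u)) at_top"
      using lower[OF \<kappa>(1)] eventually_gt_at_top[of 0]
    proof eventually_elim
      case (elim u)
      have "0 < ?p u" using elim(1) by (rule less_le_trans[OF exp_gt_zero])
      then have "- \<kappa> * sqrt u \<le> ln (?p u)" using elim(1) by (simp add: ln_ge_iff)
      then have "- \<kappa> \<le> 1 / sqrt u * ln (?p u)" using elim(2) by (simp add: field_simps)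
      then show ?case using \<kappa> by linarith
    qed
  next
    fix a assume "- decay_rate c M < a"
    \<comment> \<open>The upper bound is stated for positive \<open>\<kappa>\<close>, hence the
      maximum with 0.\<close>
    then have "max 0 (- a) < decay_rate c M" using decay_rate_pos[OF assms(2,3)] by simp
    then obtain \<kappa> where \<kappa>: "0 < \<kappa>" "- a < \<kappa>" "\<kappa> < decay_rate c M"
      using dense[of "max 0 (- a)" "decay_rate c M"] by auto
    \<comment> \<open>The lower bound at some admissible rate serves here to make the probability
      positive, so that \<open>ln\<close> is monotone at it.\<close>
    have "decay_rate c M < decay_rate c M + 1" by simp
    show "eventually (\<lambda>u. 1 / sqrt u * ln (?p u) < a) at_top"
      using upper[OF \<kappa>(1,3)] lower[OF \<open>decay_rate c M < decay_rate c M + 1\<close>] eventually_gt_at_top[of 0]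
    proof eventually_elim
      case (elim u)
      have "0 < ?p u" using elim(2) by (rule less_le_trans[OF exp_gt_zero])
      then have "ln (?p u) \<le> ln (exp (- \<kappa> * sqrt u))" using elim(1) by (simp only: ln_le_cancel_iff exp_gt_zero)
      then have "ln (?p u) \<le> - \<kappa> * sqrt u" by simp
      then have "1 / sqrt u * ln (?p u) \<le> - \<kappa>" using elim(3) by (simp add: field_simps)
      then show ?case using \<kappa> by linarith
    qed
  qed
  then show ?thesis unfolding limit .
qed

end
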